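(* The algebra $C(\operatorname{GL}_2(\hat{\mathbb Z})\backslash\operatorname{Mat}_2(\hat{\mathbb Z}))$ is the universal C$^*$-algebra generated by projections $\pi_L$, indexed by the lattices $L\supset\mathbb Z^2$, satisfying the relations $\pi_L\pi_{L'}=\pi_{L+L'}$.
   Context: $\hat{\mathbb Z}=\prod_p\mathbb Z_p$, and $\operatorname{GL}_2(\hat{\mathbb Z})$ acts on $\operatorname{Mat}_2(\hat{\mathbb Z})$ by left multiplication; continuous functions on the quotient are identified with $\operatorname{GL}_2(\hat{\mathbb Z})$-invariant continuous functions on $\operatorname{Mat}_2(\hat{\mathbb Z})$. The lattices $L$ are lattices in $\mathbb R^2$ containing $\mathbb Z^2$; each has the form $L=s^{-1}\mathbb Z^2$ with $s\in\operatorname{Mat}_2(\mathbb Z)$, $\det s>0$, where $s$ is determined up to left multiplication by $\operatorname{SL}_2(\mathbb Z)$. In $C(\operatorname{GL}_2(\hat{\mathbb Z})\backslash\operatorname{Mat}_2(\hat{\mathbb Z}))$, $\pi_L$ for $L=s^{-1}\mathbb Z^2$ is the characteristic function of the set $\operatorname{Mat}_2(\hat{\mathbb Z})s$. *)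

theory Defs
  imports "HOL-Analysis.Analysis" "HOL-Computational_Algebra.Primes"
begin

section \<open>The profinite integers\<close>

text \<open>The \<open>p\<close>-adic integers as the inverse limit of the rings of integers modulo \<open>p ^ n\<close>, each
  residue class being represented by its least nonnegative member.\<close>

definition padic_integers :: "nat \<Rightarrow> (nat \<Rightarrow> int) set" where
  "padic_integers p =
     {x. \<forall>n. x n \<in> {0..<int p ^ n} \<and> x (Suc n) mod int p ^ n = x n}"

typedef zhat = "\<Pi>\<^sub>E p\<in>{p. prime p}. padic_integers p"
  morphisms zhat_residue Abs_zhat
proof -
  have "(\<lambda>p\<in>{p. prime p}. \<lambda>n. 0) \<in> (\<Pi>\<^sub>E p\<in>{p. prime p}. padic_integers p)"
    by (auto simp: padic_integers_def prime_gt_0_nat)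
  then show ?thesis by blast
qed

lemma zhat_residue_bounds: "prime p \<Longrightarrow> 0 \<le> zhat_residue x p n \<and> zhat_residue x p n < int p ^ n"
  using zhat_residue[of x] by (auto simp: padic_integers_def PiE_iff)

lemma zhat_residue_Suc: "prime p \<Longrightarrow> zhat_residue x p (Suc n) mod int p ^ n = zhat_residue x p n"
  using zhat_residue[of x] by (auto simp: padic_integers_def PiE_iff)

lemma zhat_residue_mod [simp]: "prime p \<Longrightarrow> zhat_residue x p n mod int p ^ n = zhat_residue x p n"
  using zhat_residue_bounds[of p x n] by simp

lemma zhat_residue_0 [simp]: "prime p \<Longrightarrow> zhat_residue x p 0 = 0"
  using zhat_residue_bounds[of p x 0] by simp

lemma zhat_eqI: "(\<And>p n. prime p \<Longrightarrow> zhat_residue x p n = zhat_residue y p n) \<Longrightarrow> x = y"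
proof -
  assume *: "\<And>p n. prime p \<Longrightarrow> zhat_residue x p n = zhat_residue y p n"
  have "zhat_residue x = zhat_residue y"
    using * by (intro PiE_ext[OF zhat_residue zhat_residue]) auto
  then show ?thesis by (simp add: zhat_residue_inject)
qed

definition zhat_of :: "(nat \<Rightarrow> nat \<Rightarrow> int) \<Rightarrow> zhat" where
  "zhat_of f = Abs_zhat (\<lambda>p\<in>{p. prime p}. \<lambda>n. f p n mod int p ^ n)"

lemma mod_prime_power_Suc: "(a::int) mod q ^ Suc n mod q ^ n = a mod q ^ n"
  by (rule mod_mod_cancel) simp

lemma zhat_residue_zhat_of:
  assumes coh: "\<And>p n. prime p \<Longrightarrow> f p (Suc n) mod int p ^ n = f p n mod int p ^ n"
    and "prime p"
  shows "zhat_residue (zhat_of f) p n = f p n mod int p ^ n"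
proof -
  have "(\<lambda>p\<in>{p. prime p}. \<lambda>n. f p n mod int p ^ n) \<in> (\<Pi>\<^sub>E p\<in>{p. prime p}. padic_integers p)"
    unfolding padic_integers_def
    by (auto simp: prime_gt_0_nat mod_prime_power_Suc coh simp del: power_Suc)
  then show ?thesis
    using assms by (simp add: zhat_of_def Abs_zhat_inverse)
qed

instantiation zhat :: comm_ring_1
begin

definition "0 = zhat_of (\<lambda>p n. 0)"
definition "1 = zhat_of (\<lambda>p n. 1)"
definition "x + y = zhat_of (\<lambda>p n. zhat_residue x p n + zhat_residue y p n)"
definition "x - y = zhat_of (\<lambda>p n. zhat_residue x p n - zhat_residue y p n)"
definition "- x = zhat_of (\<lambda>p n. - zhat_residue x p n)"
definition "x * y = zhat_of (\<lambda>p n. zhat_residue x p n * zhat_residue y p n)"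

lemma zhat_residue_ring_ops [simp]:
  assumes "prime p"
  shows "zhat_residue 0 p n = 0"
    and "zhat_residue 1 p n = 1 mod int p ^ n"
    and "zhat_residue (x + y) p n = (zhat_residue x p n + zhat_residue y p n) mod int p ^ n"
    and "zhat_residue (x - y) p n = (zhat_residue x p n - zhat_residue y p n) mod int p ^ n"
    and "zhat_residue (- x) p n = (- zhat_residue x p n) mod int p ^ n"
    and "zhat_residue (x * y) p n = (zhat_residue x p n * zhat_residue y p n) mod int p ^ n"
proof -
  note defs = zero_zhat_def one_zhat_def plus_zhat_def minus_zhat_def uminus_zhat_def times_zhat_def
  have s: "zhat_residue x p (Suc n) mod int p ^ n = zhat_residue x p n mod int p ^ n"
    if "prime p" for x p n using that by (simp add: zhat_residue_Suc)
  show "zhat_residue 0 p n = 0" "zhat_residue 1 p n = 1 mod int p ^ n"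
    unfolding defs by (subst zhat_residue_zhat_of; simp add: assms)+
  show "zhat_residue (x + y) p n = (zhat_residue x p n + zhat_residue y p n) mod int p ^ n"
    unfolding defs by (rule zhat_residue_zhat_of[OF _ assms]; rule mod_add_cong; rule s)
  show "zhat_residue (x - y) p n = (zhat_residue x p n - zhat_residue y p n) mod int p ^ n"
    unfolding defs by (rule zhat_residue_zhat_of[OF _ assms]; rule mod_diff_cong; rule s)
  show "zhat_residue (- x) p n = (- zhat_residue x p n) mod int p ^ n"
    unfolding defs by (rule zhat_residue_zhat_of[OF _ assms]; rule mod_minus_cong; rule s)
  show "zhat_residue (x * y) p n = (zhat_residue x p n * zhat_residue y p n) mod int p ^ n"
    unfolding defs by (rule zhat_residue_zhat_of[OF _ assms]; rule mod_mult_cong; rule s)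
qed

instance
proof
  show "(0::zhat) \<noteq> 1"
  proof
    assume "(0::zhat) = 1"
    then have "zhat_residue 0 2 1 = zhat_residue 1 2 1" by simp
    then show False by simp
  qed
qed (rule zhat_eqI; simp add: mod_simps algebra_simps)+

end

lemma zhat_residue_of_nat [simp]: "prime p \<Longrightarrow> zhat_residue (of_nat k) p n = int k mod int p ^ n"
  by (induction k) (auto simp: mod_simps)

lemma zhat_residue_of_int [simp]: "prime p \<Longrightarrow> zhat_residue (of_int k) p n = k mod int p ^ n"
  by (cases k rule: int_cases2) (auto simp: mod_simps)

text \<open>The topology is the one induced by the product of the discrete topologies on the residues,
  i.e. the product of the \<open>p\<close>-adic topologies.\<close>

instantiation zhat :: topological_space
begin

definition open_zhat :: "zhat set \<Rightarrow> bool" where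
  "open_zhat U \<longleftrightarrow> (\<exists>V. open V \<and> U = zhat_residue -` V)"

instance
proof
  show "open (UNIV :: zhat set)" unfolding open_zhat_def by (intro exI[of _ UNIV]) auto
  show "open (S \<inter> T)" if "open S" "open T" for S T :: "zhat set"
  proof -
    from that obtain V W where "open V" "open W" "S = zhat_residue -` V" "T = zhat_residue -` W"
      unfolding open_zhat_def by blast
    then show ?thesis unfolding open_zhat_def by (intro exI[of _ "V \<inter> W"]) auto
  qed
  show "open (\<Union>K)" if "\<forall>S\<in>K. open S" for K :: "zhat set set"
  proof -
    from that obtain V where "\<forall>S\<in>K. open (V S) \<and> S = zhat_residue -` V S"
      unfolding open_zhat_def by metis
    then show ?thesis unfolding open_zhat_def by (intro exI[of _ "\<Union>S\<in>K. V S"]) auto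
  qed
qed

end

lemma continuous_on_residue: "continuous_on S (\<lambda>x. zhat_residue x p n)"
proof -
  have "continuous_on UNIV (zhat_residue :: zhat \<Rightarrow> nat \<Rightarrow> nat \<Rightarrow> int)"
    unfolding continuous_on_open_vimage[OF open_UNIV] open_zhat_def by auto
  then have "continuous_on UNIV (\<lambda>x. zhat_residue x p)"
    by (rule continuous_on_product_then_coordinatewise)
  then have "continuous_on UNIV (\<lambda>x. zhat_residue x p n)"
    by (rule continuous_on_product_then_coordinatewise)
  then show ?thesis by (rule continuous_on_subset) auto
qed

lemma open_residue_eq: "open {x. zhat_residue x p n = k}"
  using continuous_on_residue[of UNIV p n] open_discrete[of "{k}"]
  unfolding continuous_on_open_vimage[OF open_UNIV] by (auto simp: vimage_def)

instance zhat :: t2_space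
proof
  fix x y :: zhat
  assume "x \<noteq> y"
  then obtain p n where "zhat_residue x p n \<noteq> zhat_residue y p n"
    using zhat_eqI by blast
  then show "\<exists>U V. open U \<and> open V \<and> x \<in> U \<and> y \<in> V \<and> U \<inter> V = {}"
    by (intro exI[of _ "{z. zhat_residue z p n = zhat_residue x p n}"] exI[of _ "{z. zhat_residue z p n = zhat_residue y p n}"])
      (auto simp: open_residue_eq)
qed

lemma zhat_residue_notin [simp]: "\<not> prime p \<Longrightarrow> zhat_residue x p = undefined"
  using zhat_residue[of x] by (simp add: PiE_iff extensional_def)

lemma tendsto_fun_iff: "(f \<longlongrightarrow> a) F \<longleftrightarrow> (\<forall>i. ((\<lambda>x. f x i) \<longlongrightarrow> a i) F)"
  for a :: "'i \<Rightarrow> 'b::topological_space"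
  using limitin_componentwise[of "\<lambda>_. euclidean" UNIV f a F]
  by (simp add: euclidean_product_topology limitin_canonical_iff)

lemma tendsto_zhat_iff:
  "(f \<longlongrightarrow> a) F \<longleftrightarrow> (\<forall>p n. prime p \<longrightarrow> eventually (\<lambda>x. zhat_residue (f x) p n = zhat_residue a p n) F)"
    (is "?L \<longleftrightarrow> ?R")
proof
  assume L: ?L
  show ?R
  proof (intro allI impI)
    fix p n
    show "eventually (\<lambda>x. zhat_residue (f x) p n = zhat_residue a p n) F"
      using topological_tendstoD[OF L open_residue_eq[of p n "zhat_residue a p n"]] by simp
  qed
next
  assume R: ?R
  show ?L
  proof (rule topological_tendstoI)
    fix U assume "open U" "a \<in> U"
    then obtain V where V: "open V" "U = zhat_residue -` V" unfolding open_zhat_def by blast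
    have "((\<lambda>x. zhat_residue (f x)) \<longlongrightarrow> zhat_residue a) F"
      unfolding tendsto_fun_iff
    proof (intro allI)
      fix p n
      show "((\<lambda>x. zhat_residue (f x) p n) \<longlongrightarrow> zhat_residue a p n) F"
        using R by (cases "prime p") (auto simp: tendsto_discrete)
    qed
    then show "eventually (\<lambda>x. f x \<in> U) F"
      using V \<open>a \<in> U\<close> by (auto dest!: topological_tendstoD)
  qed
qed

instance zhat :: "{topological_comm_monoid_add, topological_comm_monoid_mult}"
proof
  fix a b :: zhat
  have fst: "\<forall>\<^sub>F x in nhds a \<times>\<^sub>F nhds b. zhat_residue (fst x) p n = zhat_residue a p n" if "prime p" for p n
    using that filterlim_fst[of "nhds a" "nhds b"] unfolding tendsto_zhat_iff by simp
  have snd: "\<forall>\<^sub>F x in nhds a \<times>\<^sub>F nhds b. zhat_residue (snd x) p n = zhat_residue b p n" if "prime p" for p n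
    using that filterlim_snd[of "nhds b" "nhds a"] unfolding tendsto_zhat_iff by simp
  show "((\<lambda>x. fst x + snd x) \<longlongrightarrow> a + b) (nhds a \<times>\<^sub>F nhds b)"
    unfolding tendsto_zhat_iff
  proof (intro allI impI)
    fix p n :: nat assume p: "prime p"
    show "\<forall>\<^sub>F x in nhds a \<times>\<^sub>F nhds b. zhat_residue (fst x + snd x) p n = zhat_residue (a + b) p n"
      using fst[OF p, of n] snd[OF p, of n] by eventually_elim (simp add: p)
  qed
  show "((\<lambda>x. fst x * snd x) \<longlongrightarrow> a * b) (nhds a \<times>\<^sub>F nhds b)"
    unfolding tendsto_zhat_iff
  proof (intro allI impI)
    fix p n :: nat assume p: "prime p"
    show "\<forall>\<^sub>F x in nhds a \<times>\<^sub>F nhds b. zhat_residue (fst x * snd x) p n = zhat_residue (a * b) p n"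
      using fst[OF p, of n] snd[OF p, of n] by eventually_elim (simp add: p)
  qed
qed

lemma compact_Pi_UNIV:
  fixes C :: "'i \<Rightarrow> 'b::topological_space set"
  assumes "\<And>i. compact (C i)"
  shows "compact (Pi UNIV C)"
proof -
  have "compactin (product_topology (\<lambda>_. euclidean) UNIV) (PiE UNIV C)"
    using assms by (simp add: compactin_PiE compactin_euclidean_iff)
  then show ?thesis
    by (simp add: euclidean_product_topology compactin_euclidean_iff PiE_UNIV_domain Pi_def)
qed

lemma compact_UNIV_zhat: "compact (UNIV :: zhat set)"
proof -
  define C where "C p n = (if prime p then {0..<int p ^ n} else {undefined n})" for p n
  define K where "K = Pi UNIV (\<lambda>p. Pi UNIV (C p))"
  define S where "S = range zhat_residue"
  have finC: "finite (C p n)" for p n by (simp add: C_def)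
  have "compact K"
    unfolding K_def by (intro compact_Pi_UNIV finite_imp_compact finC)
  have Sdef: "S = K \<inter> (\<Inter>p\<in>{p. prime p}. \<Inter>n. {f. f p (Suc n) mod int p ^ n = f p n})"
  proof -
    have "S = (\<Pi>\<^sub>E p\<in>{p. prime p}. padic_integers p)"
      unfolding S_def using type_definition.Rep_range[OF type_definition_zhat] .
    also have "\<dots> = K \<inter> (\<Inter>p\<in>{p. prime p}. \<Inter>n. {f. f p (Suc n) mod int p ^ n = f p n})"
      unfolding K_def C_def padic_integers_def
      by (auto simp: PiE_iff Pi_iff extensional_def fun_eq_iff split: if_splits) blast
    finally show ?thesis .
  qed
  have "closed {f::nat \<Rightarrow> nat \<Rightarrow> int. f p (Suc n) mod int p ^ n = f p n}" for p n
  proof (rule closed_Collect_eq)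
    have c: "continuous_on UNIV (\<lambda>f::nat \<Rightarrow> nat \<Rightarrow> int. f p m)" for m
      by (intro continuous_on_product_then_coordinatewise[where f = "\<lambda>f. f p"]) simp
    show "continuous_on UNIV (\<lambda>f::nat \<Rightarrow> nat \<Rightarrow> int. f p n)" by (rule c)
    have "continuous_on UNIV (\<lambda>k::int. k mod int p ^ n)" by simp
    from continuous_on_compose2[OF this c]
    show "continuous_on UNIV (\<lambda>f::nat \<Rightarrow> nat \<Rightarrow> int. f p (Suc n) mod int p ^ n)" by simp
  qed
  then have "compact S"
    unfolding Sdef using \<open>compact K\<close> by (intro compact_Int_closed closed_INT ballI)
  have "continuous_on S Abs_zhat"
    unfolding continuous_on_open_invariant
  proof (intro allI impI)
    fix B :: "zhat set" assume "open B"
    then obtain V where V: "open V" "B = zhat_residue -` V" unfolding open_zhat_def by blast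
    show "\<exists>A. open A \<and> A \<inter> S = Abs_zhat -` B \<inter> S"
      using V by (intro exI[of _ V]) (auto simp: S_def zhat_residue_inverse)
  qed
  then have "compact (Abs_zhat ` S)"
    using \<open>compact S\<close> by (rule compact_continuous_image)
  moreover have "Abs_zhat ` S = UNIV"
    unfolding S_def by (auto simp: image_image zhat_residue_inverse)
  ultimately show ?thesis by simp
qed

type_synonym 'a mat2 = "'a^2^2"

lemma compact_UNIV_mat2: "compact (UNIV :: zhat mat2 set)"
proof -
  define g :: "zhat \<times> zhat \<times> zhat \<times> zhat \<Rightarrow> zhat mat2"
    where "g = (\<lambda>(a, b, c, d). \<chi> i. \<chi> j. if i = 1 then (if j = 1 then a else b) else (if j = 1 then c else d))"
  have "compact (UNIV :: (zhat \<times> zhat \<times> zhat \<times> zhat) set)"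
    using compact_UNIV_zhat by (simp add: compact_Times flip: UNIV_Times_UNIV)
  moreover have "continuous_on UNIV g"
    unfolding g_def case_prod_beta
  proof (intro continuous_on_vec_lambda)
    fix i j :: 2
    show "continuous_on UNIV (\<lambda>x::zhat \<times> zhat \<times> zhat \<times> zhat.
      if i = 1 then if j = 1 then fst x else fst (snd x)
      else if j = 1 then fst (snd (snd x)) else snd (snd (snd x)))"
      by (cases "i = 1"; cases "j = 1") (simp_all add: continuous_intros)
  qed
  ultimately have "compact (range g)"
    by (rule compact_continuous_image[rotated])
  moreover have "A \<in> range g" for A
    by (rule range_eqI[of _ _ "(A$1$1, A$1$2, A$2$1, A$2$2)"])
       (auto simp: g_def vec_eq_iff forall_2)
  ultimately show ?thesis by (metis UNIV_eq_I)
qed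

section \<open>C*-algebras\<close>

text \<open>Not necessarily unital. The type of an algebra may be a singleton, so the zero algebra is
  included.\<close>

class cstar_algebra = real_normed_algebra + banach +
  fixes scaleC :: "complex \<Rightarrow> 'a \<Rightarrow> 'a" (infixr \<open>*\<^sub>C\<close> 75)
    and star :: "'a \<Rightarrow> 'a"
  assumes scaleR_scaleC: "r *\<^sub>R x = complex_of_real r *\<^sub>C x"
    and scaleC_add_right: "c *\<^sub>C (x + y) = c *\<^sub>C x + c *\<^sub>C y"
    and scaleC_add_left: "(c + d) *\<^sub>C x = c *\<^sub>C x + d *\<^sub>C x"
    and scaleC_scaleC: "c *\<^sub>C d *\<^sub>C x = (c * d) *\<^sub>C x"
    and mult_scaleC_left: "(c *\<^sub>C x) * y = c *\<^sub>C (x * y)"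
    and mult_scaleC_right: "x * (c *\<^sub>C y) = c *\<^sub>C (x * y)"
    and norm_scaleC: "norm (c *\<^sub>C x) = cmod c * norm x"
    and star_star: "star (star x) = x"
    and star_add: "star (x + y) = star x + star y"
    and star_scaleC: "star (c *\<^sub>C x) = cnj c *\<^sub>C star x"
    and star_mult: "star (x * y) = star y * star x"
    and norm_star_mult_self: "norm (star x * x) = (norm x)\<^sup>2"

definition projection :: "'a::cstar_algebra \<Rightarrow> bool" where
  "projection p \<longleftrightarrow> p * p = p \<and> star p = p"

definition star_hom :: "('a::cstar_algebra \<Rightarrow> 'b::cstar_algebra) \<Rightarrow> bool" where
  "star_hom f \<longleftrightarrow>
     (\<forall>x y. f (x + y) = f x + f y) \<and> (\<forall>c x. f (c *\<^sub>C x) = c *\<^sub>C f x) \<and>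
     (\<forall>x y. f (x * y) = f x * f y) \<and> (\<forall>x. f (star x) = star (f x))"

definition cstar_subalgebra :: "'a::cstar_algebra set \<Rightarrow> bool" where
  "cstar_subalgebra S \<longleftrightarrow> closed S \<and> 0 \<in> S \<and>
     (\<forall>x\<in>S. \<forall>y\<in>S. x + y \<in> S \<and> x * y \<in> S) \<and> (\<forall>c. \<forall>x\<in>S. c *\<^sub>C x \<in> S) \<and> (\<forall>x\<in>S. star x \<in> S)"

definition cstar_generated :: "'a::cstar_algebra set \<Rightarrow> 'a set" where
  "cstar_generated G = \<Inter>{S. cstar_subalgebra S \<and> G \<subseteq> S}"

section \<open>The algebra of invariant continuous functions\<close>

text \<open>\<open>invertible\<close> is the library's two-sided invertibility of matrices, so its extension on
  \<^typ>\<open>zhat mat2\<close> is the group of invertible matrices over the profinite integers.\<close>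

typedef inv_fun =
  "{f :: zhat mat2 \<Rightarrow> complex. continuous_on UNIV f \<and> (\<forall>g A. invertible g \<longrightarrow> f (g ** A) = f A)}"
  morphisms app_inv_fun Abs_inv_fun
  by (rule exI[of _ "\<lambda>_. 0"]) simp

setup_lifting type_definition_inv_fun

lemma inv_fun_eqI: "(\<And>A. app_inv_fun f A = app_inv_fun g A) \<Longrightarrow> f = g"
  by transfer auto

lemma continuous_on_inv_fun: "continuous_on UNIV (app_inv_fun f)"
  using app_inv_fun[of f] by simp

lemma bounded_inv_fun: "bounded (range (app_inv_fun f))"
  by (intro compact_imp_bounded compact_continuous_image continuous_on_inv_fun compact_UNIV_mat2)

instantiation inv_fun :: real_normed_vector
begin

lift_definition zero_inv_fun :: inv_fun is "\<lambda>_. 0" by simp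
lift_definition plus_inv_fun :: "inv_fun \<Rightarrow> inv_fun \<Rightarrow> inv_fun" is "\<lambda>f g A. f A + g A"
  by (auto intro: continuous_intros)
lift_definition minus_inv_fun :: "inv_fun \<Rightarrow> inv_fun \<Rightarrow> inv_fun" is "\<lambda>f g A. f A - g A"
  by (auto intro: continuous_intros)
lift_definition uminus_inv_fun :: "inv_fun \<Rightarrow> inv_fun" is "\<lambda>f A. - f A"
  by (auto intro: continuous_intros)
lift_definition scaleR_inv_fun :: "real \<Rightarrow> inv_fun \<Rightarrow> inv_fun" is "\<lambda>r f A. r *\<^sub>R f A"
  by (auto intro: continuous_intros)

definition norm_inv_fun :: "inv_fun \<Rightarrow> real" where
  "norm_inv_fun f = (SUP A. cmod (app_inv_fun f A))"

definition dist_inv_fun :: "inv_fun \<Rightarrow> inv_fun \<Rightarrow> real" where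
  "dist_inv_fun f g = norm (f - g)"
definition sgn_inv_fun :: "inv_fun \<Rightarrow> inv_fun" where
  "sgn_inv_fun f = inverse (norm f) *\<^sub>R f"
definition uniformity_inv_fun :: "(inv_fun \<times> inv_fun) filter" where
  "uniformity_inv_fun = (INF e\<in>{0 <..}. principal {(x, y). dist x y < e})"
definition open_inv_fun :: "inv_fun set \<Rightarrow> bool" where
  "open_inv_fun S = (\<forall>x\<in>S. \<forall>\<^sub>F (x', y) in uniformity. x' = x \<longrightarrow> y \<in> S)"

lemmas app_inv_fun_simps [simp] =
  zero_inv_fun.rep_eq plus_inv_fun.rep_eq minus_inv_fun.rep_eq uminus_inv_fun.rep_eq
  scaleR_inv_fun.rep_eq

lemma cmod_le_norm_inv_fun: "cmod (app_inv_fun f A) \<le> norm f"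
  unfolding norm_inv_fun_def
  using bounded_imp_bdd_above[OF bounded_norm_comp[THEN iffD2, OF bounded_inv_fun[of f]]]
  by (intro cSUP_upper) (auto simp: image_image)

lemma norm_inv_fun_le: "(\<And>A. cmod (app_inv_fun f A) \<le> b) \<Longrightarrow> norm f \<le> b"
  unfolding norm_inv_fun_def by (rule cSUP_least) auto

lemma norm_inv_fun_ge_0: "0 \<le> norm (f :: inv_fun)"
  using cmod_le_norm_inv_fun[of f 0] norm_ge_zero order_trans by blast

lemma norm_inv_fun_scale:
  assumes "\<And>A. cmod (app_inv_fun g A) = r * cmod (app_inv_fun f A)" "0 \<le> r"
  shows "norm g = r * norm f"
proof (cases "r = 0")
  case True
  then show ?thesis
    using assms norm_inv_fun_le[of g 0] norm_inv_fun_ge_0[of g] by simp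
next
  case False
  show ?thesis
  proof (rule antisym)
    show "norm g \<le> r * norm f"
      using assms by (intro norm_inv_fun_le) (auto intro: mult_left_mono cmod_le_norm_inv_fun)
    have "norm f \<le> norm g / r"
    proof (rule norm_inv_fun_le)
      fix A
      show "cmod (app_inv_fun f A) \<le> norm g / r"
        using assms(1)[of A] False assms(2) cmod_le_norm_inv_fun[of g A]
        by (simp add: field_simps)
    qed
    then show "r * norm f \<le> norm g"
      using False assms(2) by (simp add: field_simps)
  qed
qed

instance
proof
  fix f g :: inv_fun and r :: real
  show "dist f g = norm (f - g)" by (rule dist_inv_fun_def)
  show "sgn f = inverse (norm f) *\<^sub>R f" by (rule sgn_inv_fun_def)
  show "uniformity = (INF e\<in>{0 <..}. principal {(x::inv_fun, y). dist x y < e})"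
    by (rule uniformity_inv_fun_def)
  show "open U = (\<forall>x\<in>U. \<forall>\<^sub>F (x', y) in uniformity. x' = x \<longrightarrow> y \<in> U)" for U :: "inv_fun set"
    by (rule open_inv_fun_def)
  show "norm f = 0 \<longleftrightarrow> f = 0"
  proof
    assume "norm f = 0"
    then show "f = 0"
      using cmod_le_norm_inv_fun[of f] by (intro inv_fun_eqI) simp
  next
    assume "f = 0"
    then show "norm f = 0" by (simp add: norm_inv_fun_def)
  qed
  show "norm (f + g) \<le> norm f + norm g"
    by (rule norm_inv_fun_le)
      (auto intro: order_trans[OF norm_triangle_ineq] add_mono cmod_le_norm_inv_fun)
  show "norm (r *\<^sub>R f) = \<bar>r\<bar> * norm f" by (rule norm_inv_fun_scale) auto
qed (rule inv_fun_eqI; simp add: algebra_simps)+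

end

instance inv_fun :: banach
proof
  fix X :: "nat \<Rightarrow> inv_fun"
  assume X: "Cauchy X"
  define F where "F n = app_inv_fun (X n)" for n
  have dist_le: "dist (F m A) (F n A) \<le> dist (X m) (X n)" for m n A
    using cmod_le_norm_inv_fun[of "X m - X n" A] by (simp add: F_def dist_norm)
  have "uniformly_Cauchy_on UNIV F"
    using X dist_le unfolding uniformly_Cauchy_on_def Cauchy_def by (meson le_less_trans)
  then obtain l where l: "uniform_limit UNIV F l sequentially"
    by (auto dest!: Cauchy_uniformly_convergent simp: uniformly_convergent_uniform_limit_iff uniformly_convergent_on_def)
  have lim: "(\<lambda>n. F n A) \<longlonglongrightarrow> l A" for A
    using tendsto_uniform_limitI[OF l] by simp
  have "continuous_on UNIV l"
    by (rule uniform_limit_theorem[OF _ l]) (auto simp: F_def continuous_on_inv_fun)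
  moreover have "l (g ** A) = l A" if "invertible g" for g A
  proof -
    have "F n (g ** A) = F n A" for n
      using app_inv_fun[of "X n"] that by (simp add: F_def)
    then show ?thesis
      using lim[of "g ** A"] lim[of A] by (simp add: LIMSEQ_unique)
  qed
  ultimately obtain L where L: "app_inv_fun L = l"
    using Abs_inv_fun_inverse[of l] by auto
  have "X \<longlonglongrightarrow> L"
  proof (rule tendstoI)
    fix e :: real assume "e > 0"
    then have "\<forall>\<^sub>F n in sequentially. \<forall>A\<in>UNIV. dist (F n A) (l A) < e / 2"
      using uniform_limitD[OF l, of "e / 2"] by simp
    then show "\<forall>\<^sub>F n in sequentially. dist (X n) L < e"
    proof eventually_elim
      case (elim n)
      have "norm (X n - L) \<le> e / 2"
        using elim by (intro norm_inv_fun_le) (auto simp: F_def L dist_norm intro: less_imp_le)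
      then show ?case using \<open>e > 0\<close> by (simp add: dist_norm)
    qed
  qed
  then show "convergent X" by (rule convergentI)
qed

instantiation inv_fun :: cstar_algebra
begin

lift_definition times_inv_fun :: "inv_fun \<Rightarrow> inv_fun \<Rightarrow> inv_fun" is "\<lambda>f g A. f A * g A"
  by (auto intro: continuous_intros)
lift_definition scaleC_inv_fun :: "complex \<Rightarrow> inv_fun \<Rightarrow> inv_fun" is "\<lambda>c f A. c * f A"
  by (auto intro: continuous_intros)
lift_definition star_inv_fun :: "inv_fun \<Rightarrow> inv_fun" is "\<lambda>f A. cnj (f A)"
  by (auto intro: continuous_intros)

lemmas app_inv_fun_mult_simps [simp] =
  times_inv_fun.rep_eq scaleC_inv_fun.rep_eq star_inv_fun.rep_eq

instance
proof
  fix f g :: inv_fun and c :: complex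
  show "norm (c *\<^sub>C f) = cmod c * norm f" by (rule norm_inv_fun_scale) (auto simp: norm_mult)
  show "norm (f * g) \<le> norm f * norm g"
    by (rule norm_inv_fun_le)
      (auto simp: norm_mult intro: mult_mono cmod_le_norm_inv_fun norm_inv_fun_ge_0)
  show "norm (star f * f) = (norm f)\<^sup>2"
  proof (rule antisym)
    show "norm (star f * f) \<le> (norm f)\<^sup>2"
      by (rule norm_inv_fun_le)
        (auto simp: norm_mult power2_eq_square intro: mult_mono cmod_le_norm_inv_fun norm_inv_fun_ge_0)
    have "norm f \<le> sqrt (norm (star f * f))"
    proof (rule norm_inv_fun_le)
      fix A
      show "cmod (app_inv_fun f A) \<le> sqrt (norm (star f * f))"
        using cmod_le_norm_inv_fun[of "star f * f" A]
        by (intro real_le_rsqrt) (simp add: norm_mult power2_eq_square)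
    qed
    then show "(norm f)\<^sup>2 \<le> norm (star f * f)"
      using norm_inv_fun_ge_0[of "star f * f"] norm_inv_fun_ge_0[of f]
      by (metis real_sqrt_le_iff real_sqrt_unique)
  qed
qed (rule inv_fun_eqI; simp add: algebra_simps scaleR_conv_of_real)+

end
section \<open>Lattices and their projections\<close>

definition std_lattice :: "(real^2) set" where
  "std_lattice = {v. \<forall>i. v $ i \<in> \<int>}"

definition is_lattice :: "(real^2) set \<Rightarrow> bool" where
  "is_lattice L \<longleftrightarrow> (\<exists>v w. v \<noteq> w \<and> independent {v, w} \<and>
     L = {of_int m *\<^sub>R v + of_int n *\<^sub>R w | m n. True})"

definition superlattices :: "(real^2) set set" where
  "superlattices = {L. is_lattice L \<and> std_lattice \<subseteq> L}"

definition int_mat :: "int mat2 \<Rightarrow> 'a::ring_1 mat2" where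
  "int_mat s = (\<chi> i j. of_int (s $ i $ j))"

definition lattice_of :: "int mat2 \<Rightarrow> (real^2) set" where
  "lattice_of s = (\<lambda>v. matrix_inv (int_mat s) *v v) ` std_lattice"

definition left_ideal :: "int mat2 \<Rightarrow> zhat mat2 set" where
  "left_ideal s = {A ** int_mat s | A. True}"

text \<open>The matrix \<open>s\<close> is only determined by the lattice up to left multiplication by
  integral matrices of determinant one, but the left ideal it generates does not depend on the
  choice: see \<open>app_lattice_proj\<close> below. By \<open>superlattice_obtains\<close>, every
  lattice containing the standard one has this form.\<close>

definition lattice_proj :: "(real^2) set \<Rightarrow> inv_fun" where
  "lattice_proj L =
     (THE f. \<forall>s. det s > 0 \<and> L = lattice_of s \<longrightarrow> app_inv_fun f = indicator (left_ideal s))"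

text \<open>The standard lattice is itself an index, so \<open>\<rho> std_lattice\<close> acts as a unit on the
  whole family; no unit of the ambient algebra is required.\<close>

definition lattice_projection_family :: "((real^2) set \<Rightarrow> 'a::cstar_algebra) \<Rightarrow> bool" where
  "lattice_projection_family \<rho> \<longleftrightarrow>
     (\<forall>L\<in>superlattices. projection (\<rho> L)) \<and>
     (\<forall>L\<in>superlattices. \<forall>L'\<in>superlattices. \<rho> L * \<rho> L' = \<rho> (L + L'))"

lemma of_nat_mult_cancel_zhat:
  fixes x :: zhat
  assumes "prime q" "of_nat q * x = 0"
  shows "x = 0"
proof (rule zhat_eqI)
  fix p n :: nat assume p: "prime p"
  have dvd: "int p ^ k dvd int q * zhat_residue x p k" for k
  proof -
    have "zhat_residue (of_nat q * x) p k = 0" using assms p by simp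
    then show ?thesis using p by (simp add: mod_simps mod_eq_0_iff_dvd)
  qed
  show "zhat_residue x p n = zhat_residue 0 p n"
  proof (cases "p = q")
    case True
    have "int q * int q ^ n dvd int q * zhat_residue x q (Suc n)"
      using dvd[of "Suc n"] True by simp
    then have "int p ^ n dvd zhat_residue x p (Suc n)"
      using True assms(1) by (simp add: prime_gt_0_nat)
    then show ?thesis
      using zhat_residue_Suc[OF p, of x n] p by (simp add: dvd_imp_mod_0)
  next
    case False
    then have "coprime (int p ^ n) (int q)"
      using p assms(1) by (simp add: primes_coprime)
    then have "int p ^ n dvd zhat_residue x p n"
      using dvd[of n] by (simp add: coprime_dvd_mult_right_iff)
    then show ?thesis
      using zhat_residue_mod[OF p, of x n] p by simp
  qed
qed

lemma prime_dvd_zhat_iff: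
  assumes q: "prime q"
  shows "of_nat q dvd x \<longleftrightarrow> zhat_residue x q 1 = 0"
proof
  assume "of_nat q dvd x"
  then show "zhat_residue x q 1 = 0" using q by (auto elim!: dvdE)
next
  assume x: "zhat_residue x q 1 = 0"
  have "\<exists>r. (int q * r) mod int p ^ n = zhat_residue x p n" if p: "prime p" "p \<noteq> q" for p n
  proof -
    have "coprime (int q) (int p ^ n)"
      using that q by (simp add: primes_coprime)
    then obtain u v where "u * int q + v * int p ^ n = 1"
      using bezout_int[of "int q" "int p ^ n"] by auto
    then have "zhat_residue x p n = zhat_residue x p n * (u * int q + v * int p ^ n)" by simp
    also have "\<dots> = int q * (u * zhat_residue x p n) + int p ^ n * (v * zhat_residue x p n)"
      by (simp add: algebra_simps)
    finally have "(int q * (u * zhat_residue x p n)) mod int p ^ n = zhat_residue x p n mod int p ^ n"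
      by (metis mod_mult_self2)
    then show ?thesis using p by auto
  qed
  then obtain r where r: "\<And>p n. prime p \<Longrightarrow> p \<noteq> q \<Longrightarrow> (int q * r p n) mod int p ^ n = zhat_residue x p n"
    by metis
  define f where "f p n = (if p = q then zhat_residue x q (Suc n) div int q else r p n)" for p n
  have "zhat_residue x q (Suc n) mod int q = 0" for n
  proof (induction n)
    case (Suc n)
    have "zhat_residue x q (Suc (Suc n)) mod int q = zhat_residue x q (Suc n) mod int q"
      unfolding zhat_residue_Suc[OF q, of x "Suc n", symmetric] by (simp add: mod_mod_cancel)
    then show ?case using Suc by simp
  qed (use x in simp)
  then have qdiv: "int q * f q n = zhat_residue x q (Suc n)" for n
    by (simp add: f_def mod_eq_0_iff_dvd)
  have fx: "(int q * f p n) mod int p ^ n = zhat_residue x p n" if "prime p" for p n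
    using that qdiv r zhat_residue_Suc by (cases "p = q") (auto simp: f_def)
  have "f p (Suc n) mod int p ^ n = f p n mod int p ^ n" if p: "prime p" for p n
  proof (cases "p = q")
    case True
    have "int q * (int q ^ n) dvd int q * f q (Suc n) - int q * f q n"
      using zhat_residue_Suc[OF q, of x "Suc n"] zhat_residue_mod[OF q, of x "Suc n"]
      unfolding qdiv power_Suc[symmetric] mod_eq_dvd_iff[symmetric] by (simp del: power_Suc)
    then have "int q ^ n dvd f q (Suc n) - f q n"
      using q by (simp add: prime_gt_0_nat flip: right_diff_distrib)
    then show ?thesis using True by (simp add: mod_eq_dvd_iff)
  next
    case False
    have "(int q * f p (Suc n)) mod int p ^ n = (int q * f p n) mod int p ^ n"
      unfolding fx[OF p] mod_prime_power_Suc[symmetric, of "int q * f p (Suc n)"]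
      by (rule zhat_residue_Suc[OF p])
    then have "int p ^ n dvd int q * (f p (Suc n) - f p n)"
      by (simp add: mod_eq_dvd_iff right_diff_distrib)
    moreover have "coprime (int p ^ n) (int q)"
      using p False q by (simp add: primes_coprime)
    ultimately show ?thesis
      by (simp add: coprime_dvd_mult_right_iff mod_eq_dvd_iff)
  qed
  then have "zhat_residue (zhat_of f) p n = f p n mod int p ^ n" if "prime p" for p n
    using that by (intro zhat_residue_zhat_of)
  then have "x = of_nat q * zhat_of f"
    using fx by (intro zhat_eqI) (simp add: mod_simps)
  then show "of_nat q dvd x" by simp
qed

lemma of_nat_eq_0_zhat: "0 < d \<Longrightarrow> of_nat d * x = 0 \<Longrightarrow> x = 0" for x :: zhat
proof (induction d arbitrary: x rule: less_induct)
  case (less d)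
  show ?case
  proof (cases "d = 1")
    case False
    then obtain q where q: "prime q" "q dvd d" using prime_factor_nat by blast
    then obtain e where e: "d = q * e" by (auto elim: dvdE)
    then have "of_nat q * (of_nat e * x) = 0" using less.prems by (simp add: mult.assoc)
    then have "of_nat e * x = 0" using q(1) of_nat_mult_cancel_zhat by blast
    moreover have "0 < e" "e < d" using e q(1) less.prems(1) prime_gt_1_nat by auto
    ultimately show ?thesis using less.IH by blast
  qed (use less in simp)
qed

lemma clopen_dvd_zhat: "0 < d \<Longrightarrow> open {x::zhat. of_nat d dvd x} \<and> closed {x::zhat. of_nat d dvd x}"
proof (induction d rule: less_induct)
  case (less d)
  have "{x::zhat. of_nat d dvd x} = range (\<lambda>x. of_nat d * x)" by (auto simp: dvd_def)
  moreover have "compact (range (\<lambda>x::zhat. of_nat d * x))"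
    by (intro compact_continuous_image compact_UNIV_zhat continuous_intros)
  ultimately have closed: "closed {x::zhat. of_nat d dvd x}"
    by (simp add: compact_imp_closed)
  show ?case
  proof (cases "d = 1")
    case False
    then obtain q where q: "prime q" "q dvd d" using prime_factor_nat by blast
    then obtain e where e: "d = q * e" by (auto elim: dvdE)
    have e': "0 < e" "e < d" using e q(1) less.prems(1) prime_gt_1_nat by auto
    define E where "E = {x::zhat. of_nat e dvd x}"
    have E: "open E" using less.IH e' by (simp add: E_def)
    have "closed ((\<lambda>x. of_nat q * x) ` (- E))"
      using E compact_Int_closed[OF compact_UNIV_zhat, of "- E"]
      by (intro compact_imp_closed compact_continuous_image continuous_intros) (simp add: closed_Compl)
    then have "open ({x. zhat_residue x q 1 = 0} - (\<lambda>x. of_nat q * x) ` (- E))"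
      by (intro open_Diff open_residue_eq)
    moreover have "{x. zhat_residue x q 1 = 0} - (\<lambda>x. of_nat q * x) ` (- E) = {x. of_nat d dvd x}"
    proof -
      have inj: "a = b" if "of_nat q * a = of_nat q * b" for a b :: zhat
        using of_nat_mult_cancel_zhat[OF q(1), of "a - b"] that by (simp add: right_diff_distrib)
      have "of_nat d dvd x \<longleftrightarrow> (\<exists>y\<in>E. x = of_nat q * y)" for x :: zhat
        unfolding E_def e by (auto simp: dvd_def mult.assoc)
      then show ?thesis
        unfolding prime_dvd_zhat_iff[OF q(1), symmetric] by (auto simp: dvd_def dest: inj)
    qed
    ultimately show ?thesis using closed by simp
  qed simp
qed

lemma int_mat_mult: "int_mat (s ** t) = int_mat s ** (int_mat t :: 'a::ring_1 mat2)"
  by (simp add: int_mat_def matrix_matrix_mult_def vec_eq_iff)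

lemma det_int_mat: "det (int_mat s :: 'a::comm_ring_1 mat2) = of_int (det s)"
  by (simp add: det_2 int_mat_def)

lemma inj_int_mat: "int_mat s = (int_mat t :: real mat2) \<Longrightarrow> s = t"
  by (simp add: int_mat_def vec_eq_iff)

definition adjugate2 :: "'a::comm_ring_1 mat2 \<Rightarrow> 'a mat2" where
  "adjugate2 S = (\<chi> i j. if i = 1 then (if j = 1 then S $ 2 $ 2 else - S $ 1 $ 2)
                          else (if j = 1 then - S $ 2 $ 1 else S $ 1 $ 1))"

lemma adjugate2: "S ** adjugate2 S = mat (det S)" "adjugate2 S ** S = mat (det S)"
  by (simp_all add: adjugate2_def matrix_matrix_mult_def vec_eq_iff forall_2 sum_2 det_2 mat_def algebra_simps)

lemma mat_mult_2: "(A ** mat c) $ i $ j = A $ i $ j * c" "(mat c ** A) $ i $ j = c * A $ i $ j"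
  for A :: "'a::comm_ring_1 mat2"
  using exhaust_2[of i] exhaust_2[of j]
  by (auto simp: matrix_matrix_mult_def mat_def sum_2)

lemma left_ideal_iff:
  assumes "det s > 0"
  shows "A \<in> left_ideal s \<longleftrightarrow>
    (\<forall>i j. of_nat (nat (det s)) dvd (A ** adjugate2 (int_mat s :: zhat mat2)) $ i $ j)"
proof -
  let ?S = "int_mat s :: zhat mat2"
  have d: "of_nat (nat (det s)) = det ?S"
    using assms by (simp add: det_int_mat of_nat_nat)
  show ?thesis unfolding d
  proof
    assume "A \<in> left_ideal s"
    then obtain B where "A = B ** ?S" unfolding left_ideal_def by blast
    then have "A ** adjugate2 ?S = B ** mat (det ?S)"
      by (simp add: adjugate2(1) flip: matrix_mul_assoc)
    then show "\<forall>i j. det ?S dvd (A ** adjugate2 ?S) $ i $ j"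
      by (simp add: mat_mult_2)
  next
    assume *: "\<forall>i j. det ?S dvd (A ** adjugate2 ?S) $ i $ j"
    define B :: "zhat mat2"
      where "B = (\<chi> i j. SOME b. (A ** adjugate2 ?S) $ i $ j = det ?S * b)"
    have B: "(A ** adjugate2 ?S) $ i $ j = det ?S * B $ i $ j" for i j
      using someI_ex[OF *[rule_format, of i j, unfolded dvd_def]] by (simp add: B_def)
    then have "A ** adjugate2 ?S = mat (det ?S) ** B"
      by (simp add: vec_eq_iff mat_mult_2)
    then have "A ** mat (det ?S) = mat (det ?S) ** (B ** ?S)"
      by (metis adjugate2(2) matrix_mul_assoc)
    then have eq: "det ?S * A $ i $ j = det ?S * (B ** ?S) $ i $ j" for i j
      by (metis mat_mult_2 mult.commute)
    have "A $ i $ j = (B ** ?S) $ i $ j" for i j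
      using of_nat_eq_0_zhat[of "nat (det s)" "A $ i $ j - (B ** ?S) $ i $ j"] assms eq[of i j]
      by (simp only: d right_diff_distrib) simp
    then have "A = B ** ?S" by (simp add: vec_eq_iff)
    then show "A \<in> left_ideal s" unfolding left_ideal_def by blast
  qed
qed

lemma clopen_left_ideal:
  assumes "det s > 0"
  shows "open (left_ideal s)" "closed (left_ideal s)"
proof -
  let ?D = "{x::zhat. of_nat (nat (det s)) dvd x}"
  let ?f = "\<lambda>i j A. (A ** adjugate2 (int_mat s :: zhat mat2)) $ i $ j"
  have cont: "continuous_on UNIV (?f i j)" for i j
    unfolding matrix_matrix_mult_def by (simp add: sum_2) (intro continuous_intros)
  have eq: "left_ideal s = (\<Inter>i\<in>UNIV. \<Inter>j\<in>UNIV. ?f i j -` ?D)"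
    using left_ideal_iff[OF assms] by auto
  have D: "open ?D" "closed ?D" using clopen_dvd_zhat[of "nat (det s)"] assms by auto
  have "open (?f i j -` ?D)" for i j by (rule open_vimage[OF D(1) cont])
  then show "open (left_ideal s)" unfolding eq by (intro open_INT ballI) auto
  have "closed (?f i j -` ?D)" for i j by (rule closed_vimage[OF D(2) cont])
  then show "closed (left_ideal s)" unfolding eq by (intro closed_INT ballI)
qed

lemma left_ideal_invertible:
  assumes "invertible g"
  shows "g ** A \<in> left_ideal s \<longleftrightarrow> A \<in> left_ideal s"
proof -
  obtain h where h: "h ** g = mat 1" using assms unfolding invertible_def by blast
  have *: "B ** A \<in> left_ideal s" if "A \<in> left_ideal s" for A B
    using that unfolding left_ideal_def by (auto simp: matrix_mul_assoc)
  have "h ** (g ** A) = A" by (simp add: matrix_mul_assoc h)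
  then show ?thesis using *[of A g] *[of "g ** A" h] by auto
qed

lemma ex_app_indicator:
  assumes "det s > 0"
  shows "\<exists>f. app_inv_fun f = indicator (left_ideal s)"
proof -
  have "continuous_on UNIV (indicator (left_ideal s) :: zhat mat2 \<Rightarrow> complex)"
    unfolding continuous_on_open_vimage[OF open_UNIV]
  proof (intro allI impI)
    fix B :: "complex set"
    have "indicator (left_ideal s) -` B \<inter> UNIV =
       (if 1 \<in> B then left_ideal s else {}) \<union> (if 0 \<in> B then - left_ideal s else {})"
    proof (rule set_eqI)
      fix A
      show "A \<in> indicator (left_ideal s) -` B \<inter> UNIV \<longleftrightarrow>
        A \<in> (if 1 \<in> B then left_ideal s else {}) \<union> (if 0 \<in> B then - left_ideal s else {})"
        by (cases "A \<in> left_ideal s") simp_all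
    qed
    then show "open (indicator (left_ideal s) -` B \<inter> UNIV)"
      using clopen_left_ideal[OF assms] by (auto simp: open_Un open_Compl)
  qed
  then show ?thesis
    using Abs_inv_fun_inverse[of "indicator (left_ideal s)"]
    by (auto simp: left_ideal_invertible indicator_def)
qed

lemma matrix_inv_mult:
  assumes "invertible A"
  shows "A ** matrix_inv A = mat 1" "matrix_inv A ** A = mat 1"
  using someI_ex[OF assms[unfolded invertible_def]] unfolding matrix_inv_def by auto

lemma lattice_of_eq_imp_mult:
  assumes "det s > 0" "det t > 0" "lattice_of s = lattice_of t"
  shows "\<exists>u. t = u ** s"
proof -
  let ?S = "int_mat s :: real mat2" and ?T = "int_mat t :: real mat2"
  have inv: "invertible ?S" "invertible ?T"
    using assms by (simp_all add: invertible_det_nz det_int_mat)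
  let ?U = "?T ** matrix_inv ?S"
  have "?U $ i $ j \<in> \<int>" for i j
  proof -
    have "axis j 1 \<in> std_lattice" by (auto simp: std_lattice_def axis_def)
    then have "matrix_inv ?S *v axis j 1 \<in> lattice_of t"
      using assms(3) unfolding lattice_of_def by blast
    then obtain w where w: "w \<in> std_lattice" "matrix_inv ?S *v axis j 1 = matrix_inv ?T *v w"
      unfolding lattice_of_def by blast
    have "?U *v axis j 1 = (?T ** matrix_inv ?T) *v w"
      by (simp add: w(2) flip: matrix_vector_mul_assoc)
    then have "column j ?U = w"
      using inv by (simp add: matrix_inv_mult matrix_vector_mult_basis)
    then show ?thesis using w(1) by (auto simp: std_lattice_def column_def)
  qed
  then have "?U = int_mat (\<chi> i j. \<lfloor>?U $ i $ j\<rfloor>)"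
    by (simp add: int_mat_def vec_eq_iff)
  then obtain u where u: "?U = int_mat u" by blast
  have "?T = ?U ** ?S" using inv by (simp add: matrix_inv_mult flip: matrix_mul_assoc)
  then have "t = u ** s" unfolding u int_mat_mult[symmetric] by (rule inj_int_mat)
  then show ?thesis by blast
qed

lemma left_ideal_mult_subset: "left_ideal (u ** s) \<subseteq> left_ideal s"
  unfolding left_ideal_def int_mat_mult by (auto simp: matrix_mul_assoc)

lemma app_lattice_proj:
  assumes "det s > 0"
  shows "app_inv_fun (lattice_proj (lattice_of s)) = indicator (left_ideal s)"
proof -
  obtain f where f: "app_inv_fun f = indicator (left_ideal s)"
    using ex_app_indicator[OF assms] by blast
  have eq: "left_ideal t = left_ideal s" if t: "det t > 0" "lattice_of s = lattice_of t" for t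
  proof -
    obtain u where "t = u ** s"
      using lattice_of_eq_imp_mult[OF assms t] by blast
    moreover obtain u' where "s = u' ** t"
      using lattice_of_eq_imp_mult[OF t(1) assms t(2)[symmetric]] by blast
    ultimately show ?thesis
      using left_ideal_mult_subset[of u s] left_ideal_mult_subset[of u' t] by simp
  qed
  have "lattice_proj (lattice_of s) = f"
    unfolding lattice_proj_def
  proof (rule the_equality)
    show "\<forall>t. det t > 0 \<and> lattice_of s = lattice_of t \<longrightarrow> app_inv_fun f = indicator (left_ideal t)"
      using f eq by simp
    fix h
    assume "\<forall>t. det t > 0 \<and> lattice_of s = lattice_of t \<longrightarrow> app_inv_fun h = indicator (left_ideal t)"
    then have "app_inv_fun h = indicator (left_ideal s)" using assms by blast
    then show "h = f" using f by (simp add: app_inv_fun_inject[symmetric])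
  qed
  then show ?thesis using f by simp
qed

lemma superlattice_obtains:
  assumes "L \<in> superlattices"
  obtains s where "det s > 0" "L = lattice_of s"
proof -
  obtain v w where vw: "v \<noteq> w" "independent {v, w}"
    and L: "L = {of_int m *\<^sub>R v + of_int n *\<^sub>R w | m n. True}" and sub: "std_lattice \<subseteq> L"
    using assms unfolding superlattices_def is_lattice_def by blast
  have "\<exists>m n. axis j 1 = of_int m *\<^sub>R v + of_int n *\<^sub>R w" for j
  proof -
    have "axis j 1 \<in> std_lattice" by (auto simp: std_lattice_def axis_def)
    then show ?thesis using sub L by blast
  qed
  then obtain m n where mn: "\<And>j. axis j 1 = of_int (m j) *\<^sub>R v + of_int (n j) *\<^sub>R w"
    by metis
  define B :: "real mat2" where "B = (\<chi> i j. if j = 1 then v $ i else w $ i)"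
  define s0 :: "int mat2" where "s0 = (\<chi> i j. if i = 1 then m j else n j)"
  define e :: int where "e = sgn (det s0)"
  define s :: "int mat2" where "s = (\<chi> i j. if i = 1 then e * m j else n j)"
  have Bv: "B *v x = (x $ 1) *\<^sub>R v + (x $ 2) *\<^sub>R w" for x
    by (simp add: B_def matrix_vector_mult_def vec_eq_iff sum_2 algebra_simps)
  have BS0: "B ** int_mat s0 = mat 1"
  proof -
    have "(B ** int_mat s0) $ i $ j = (axis j 1 :: real^2) $ i" for i j
      unfolding mn by (simp add: B_def s0_def int_mat_def matrix_matrix_mult_def sum_2 algebra_simps)
    then show ?thesis by (auto simp: vec_eq_iff mat_def axis_def)
  qed
  have "det B * of_int (det s0) = 1"
    using arg_cong[OF BS0, of det] by (simp add: det_mul det_int_mat)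
  then have "det s0 \<noteq> 0" by auto
  then have e: "e = 1 \<or> e = -1" and "e * det s0 > 0"
    by (auto simp: e_def sgn_if)
  moreover have "det s = e * det s0" by (simp add: det_2 s_def s0_def algebra_simps)
  ultimately have det: "det s > 0" by simp
  define B' :: "real mat2" where "B' = (\<chi> i j. if j = 1 then of_int e * v $ i else w $ i)"
  have B'v: "B' *v x = (of_int e * x $ 1) *\<^sub>R v + (x $ 2) *\<^sub>R w" for x
    by (simp add: B'_def matrix_vector_mult_def vec_eq_iff sum_2 algebra_simps)
  have "B' ** int_mat s = B ** int_mat s0"
    using e by (auto simp: B'_def s_def B_def s0_def int_mat_def matrix_matrix_mult_def sum_2 vec_eq_iff)
  then have B'S: "B' ** int_mat s = mat 1" using BS0 by simp
  then have "int_mat s ** B' = mat 1" by (simp add: matrix_left_right_inverse)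
  then have "invertible (int_mat s :: real mat2)"
    using B'S unfolding invertible_def by blast
  then have "B' ** (int_mat s ** matrix_inv (int_mat s)) = B'"
    by (simp add: matrix_inv_mult)
  then have inv: "matrix_inv (int_mat s) = B'"
    by (simp add: matrix_mul_assoc B'S)
  have "L = (\<lambda>x. B' *v x) ` std_lattice"
  proof (intro equalityI subsetI)
    fix y assume "y \<in> L"
    then obtain k l where y: "y = of_int k *\<^sub>R v + of_int l *\<^sub>R w" unfolding L by blast
    have "y = B' *v (\<chi> i. if i = 1 then of_int (e * k) else of_int l)"
      unfolding B'v y using e by auto
    moreover have "(\<chi> i. if i = 1 then of_int (e * k) else of_int l) \<in> std_lattice"
      by (auto simp: std_lattice_def)
    ultimately show "y \<in> (\<lambda>x. B' *v x) ` std_lattice" by blast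
  next
    fix y assume "y \<in> (\<lambda>x. B' *v x) ` std_lattice"
    then obtain x where x: "x \<in> std_lattice" "y = B' *v x" by blast
    then have "x $ 1 \<in> \<int>" "x $ 2 \<in> \<int>" by (simp_all add: std_lattice_def)
    then obtain k l where "x $ 1 = of_int k" "x $ 2 = of_int l"
      unfolding Ints_def by fast
    then have "y = of_int (e * k) *\<^sub>R v + of_int l *\<^sub>R w" by (simp add: x(2) B'v)
    then show "y \<in> L" unfolding L by blast
  qed
  then show ?thesis using that[OF det] inv unfolding lattice_of_def by simp
qed

end

theory Submission
  imports Defs
begin

text \<open>Write \<open>A L\<close> for the image of a lattice \<open>L\<close> under a profinite matrix \<open>A\<close>. The set
\<open>Mat\<^sub>2 s\<close> consists of the \<open>A\<close> with \<open>A L\<close> integral, where \<open>L = s\<^sup>-\<^sup>1 \<int>\<^sup>2\<close>, and a matrix is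
integral on \<open>L\<close> and on \<open>L'\<close> exactly if it is integral on \<open>L + L'\<close>. This gives the relations
between the projections \<open>\<pi>\<^sub>L\<close> (\<open>lattice_projection_family_lattice_proj\<close>).

The other two claims rest on finite levels. The lattices \<open>L\<close> with \<open>N L \<subseteq> \<int>\<^sup>2\<close> form a finite set
closed under sums, so any projections \<open>\<rho> L\<close> with \<open>\<rho> L \<rho> L' = \<rho> (L + L')\<close> decompose, by Moebius
inversion, as \<open>\<rho> L = \<Sum> e M\<close>, the sum taken over the lattices \<open>M \<supseteq> L\<close> of that level, with pairwise
orthogonal projections \<open>e M\<close>. The character of the semilattice that belongs to \<open>e M\<close> sends \<open>L\<close> to \<open>1\<close>
iff \<open>L \<subseteq> M\<close>, and evaluation at an integral matrix \<open>t\<close> with \<open>M = t\<^sup>-\<^sup>1 \<int>\<^sup>2\<close> realises it. Hence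
\<open>f \<mapsto> \<Sum> f(t\<^sub>M) e M\<close> is a star homomorphism defined on all invariant functions, and it sends \<open>\<pi>\<^sub>L\<close> to
\<open>\<rho> L\<close> for every \<open>L\<close> of the level (\<open>star_hom_level_hom\<close>, \<open>level_hom_lattice_proj\<close>).

Generation: taking \<open>\<rho> L = \<pi>\<^sub>L\<close>, these sums come arbitrarily close to \<open>f\<close> (\<open>level_hom_approximates\<close>). Indeed \<open>f\<close> is
constant up to \<open>\<epsilon>\<close> on residue classes modulo a suitable \<open>N\<close>, and two matrices that are integral on
the same lattices of level \<open>N\<close> lie in one orbit modulo \<open>N\<close> (\<open>same_orbit_mod_level\<close>). For the latter,
Hermite normal forms show that each of the two matrices is a left multiple of the other modulo
\<open>N\<close>, and the stable range condition for \<open>2 \<times> 2\<close> matrices over the profinite integers replaces the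
multiplier by an invertible one (\<open>stable_range\<close>).

Universal property: a star homomorphism on invariant functions is contractive
(\<open>star_hom_norm_le\<close>). Therefore two homomorphisms that agree on the generators are equal, and the
set of \<open>f\<close> at which the finite-level homomorphisms converge is a closed star subalgebra. It contains
the generators, so it is everything, and the pointwise limit is the required homomorphism.\<close>

section \<open>Lattices as groups of rational vectors\<close>

definition int_vec :: "int^2 \<Rightarrow> 'a::ring_1^2" where
  "int_vec w = (\<chi> i. of_int (w $ i))"

lemma int_vec_nth [simp]: "int_vec w $ i = of_int (w $ i)"
  by (simp add: int_vec_def)

lemma int_mat_vec: "int_mat s *v int_vec w = (int_vec (s *v w) :: 'a::ring_1^2)"
  by (simp add: vec_eq_iff int_mat_def matrix_vector_mult_def)

lemma std_lattice_eq: "std_lattice = range int_vec"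
proof (intro equalityI subsetI)
  fix x :: "real^2" assume "x \<in> std_lattice"
  then have "x = int_vec (\<chi> i. \<lfloor>x $ i\<rfloor>)" by (simp add: std_lattice_def vec_eq_iff)
  then show "x \<in> range int_vec" by blast
qed (auto simp: std_lattice_def)

lemma std_lattice_diff: "x \<in> std_lattice \<Longrightarrow> y \<in> std_lattice \<Longrightarrow> x - y \<in> std_lattice"
  by (simp add: std_lattice_def)

lemma std_lattice_scaleR: "x \<in> std_lattice \<Longrightarrow> c \<in> \<int> \<Longrightarrow> c *\<^sub>R x \<in> std_lattice"
  by (simp add: std_lattice_def)

lemma mem_lattice_of:
  assumes "det s > 0"
  shows "x \<in> lattice_of s \<longleftrightarrow> int_mat s *v x \<in> std_lattice"
proof -
  let ?S = "int_mat s :: real mat2"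
  have inv: "invertible ?S" using assms by (simp add: invertible_det_nz det_int_mat)
  have cancel: "?S *v (matrix_inv ?S *v y) = y" "matrix_inv ?S *v (?S *v y) = y" for y
    by (simp_all add: matrix_vector_mul_assoc matrix_inv_mult[OF inv])
  show ?thesis unfolding lattice_of_def
    by (auto simp: cancel intro: rev_image_eqI)
qed

text \<open>This is \<open>\<int>\<close> being a principal ideal domain, for subsets closed under differences; it supplies the
two pivots of the Hermite form.\<close>

lemma int_subgroup_generator:
  fixes I :: "int set"
  assumes "n \<in> I" "n > 0" and diff: "\<And>x y. x \<in> I \<Longrightarrow> y \<in> I \<Longrightarrow> x - y \<in> I"
  obtains g where "g \<in> I" "g > 0" "\<And>x. x \<in> I \<Longrightarrow> g dvd x"
proof -
  have zero: "0 \<in> I" using diff[OF assms(1) assms(1)] by simp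
  have uminus: "- x \<in> I" if "x \<in> I" for x using diff[OF zero that] by simp
  have add: "x + y \<in> I" if "x \<in> I" "y \<in> I" for x y using diff[OF that(1) uminus[OF that(2)]] by simp
  have mult: "k * x \<in> I" if x: "x \<in> I" for k x
  proof (induction k rule: int_induct[where k = 0])
    case (step1 i) then show ?case using add[OF _ x] by (simp add: distrib_right)
  next
    case (step2 i) then show ?case using diff[OF _ x] by (simp add: left_diff_distrib)
  qed (simp add: zero)
  define g where "g = (LEAST m::nat. 0 < m \<and> int m \<in> I)"
  have "0 < nat n \<and> int (nat n) \<in> I" using assms by simp
  then have g: "0 < g" "int g \<in> I" unfolding g_def by (metis (mono_tags, lifting) LeastI)+
  have "int g dvd x" if "x \<in> I" for x
  proof (rule ccontr)
    assume "\<not> int g dvd x"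
    then have "x mod int g \<noteq> 0" by (simp add: dvd_eq_mod_eq_0)
    then have pos: "0 < x mod int g" using g pos_mod_sign[of "int g" x] by linarith
    have "x mod int g = x - (x div int g) * int g" by (simp add: minus_div_mult_eq_mod)
    then have "x mod int g \<in> I" using diff[OF that mult[OF g(2)]] by simp
    then have "0 < nat (x mod int g) \<and> int (nat (x mod int g)) \<in> I" using pos by simp
    then have "g \<le> nat (x mod int g)" unfolding g_def by (rule Least_le)
    then show False using pos g(1) pos_mod_bound[of "int g" x] by linarith
  qed
  then show ?thesis using that[of "int g"] g by simp
qed

text \<open>Row Hermite normal form: the first pivot generates the first coordinates of \<open>H\<close>, the second pivot
generates the part of \<open>H\<close> whose first coordinate vanishes. Both are nonzero because \<open>H\<close> contains
\<open>N \<int>\<^sup>2\<close>.\<close>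

lemma hermite_basis:
  fixes H :: "(int^2) set"
  assumes N: "N > 0" "\<And>w. N *s w \<in> H" and diff: "\<And>x y. x \<in> H \<Longrightarrow> y \<in> H \<Longrightarrow> x - y \<in> H"
  obtains s :: "int mat2" where "s $ 2 $ 1 = 0" "s $ 1 $ 1 > 0" "s $ 2 $ 2 > 0"
    "H = range (\<lambda>z. z v* s)"
proof -
  have zero: "0 \<in> H" using N(2)[of 0] by simp
  have uminus: "- x \<in> H" if "x \<in> H" for x using diff[OF zero that] by simp
  have add: "x + y \<in> H" if "x \<in> H" "y \<in> H" for x y using diff[OF that(1) uminus[OF that(2)]] by simp
  have mult: "k *s x \<in> H" if x: "x \<in> H" for k x
  proof (induction k rule: int_induct[where k = 0])
    case (step1 i) then show ?case using add[OF _ x] by (simp add: vector_sadd_rdistrib)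
  next
    case (step2 i) then show ?case using diff[OF _ x] by (simp add: vec_eq_iff left_diff_distrib)
  qed (simp add: zero)
  \<comment> \<open>first pivot: generates the first coordinates of \<open>H\<close>\<close>
  obtain a where a: "a \<in> (\<lambda>h. h $ 1) ` H" "a > 0" "\<And>x. x \<in> (\<lambda>h. h $ 1) ` H \<Longrightarrow> a dvd x"
  proof (rule int_subgroup_generator[of N "(\<lambda>h. h $ 1) ` H"])
    show "N \<in> (\<lambda>h. h $ 1) ` H" using N(2)[of "axis 1 1"] by (force simp: axis_def)
    show "x - y \<in> (\<lambda>h. h $ 1) ` H" if "x \<in> (\<lambda>h. h $ 1) ` H" "y \<in> (\<lambda>h. h $ 1) ` H" for x y
      using that diff by (auto simp: image_iff) (metis vector_minus_component)
  qed (use N in auto)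
  \<comment> \<open>second pivot: generates the vectors of \<open>H\<close> on the second axis\<close>
  obtain d where d: "axis 2 d \<in> H" "d > 0" "\<And>k. axis 2 k \<in> H \<Longrightarrow> d dvd k"
  proof (rule int_subgroup_generator[of N "{k. axis 2 k \<in> H}"])
    have "N *s axis 2 1 = (axis 2 N :: int^2)" by (simp add: vec_eq_iff axis_def)
    then show "N \<in> {k. axis 2 k \<in> H}" using N(2)[of "axis 2 1"] by simp
    show "x - y \<in> {k. axis 2 k \<in> H}" if "x \<in> {k. axis 2 k \<in> H}" "y \<in> {k. axis 2 k \<in> H}" for x y
    proof -
      have "axis 2 (x - y) = axis 2 x - (axis 2 y :: int^2)" by (simp add: vec_eq_iff axis_def)
      then show ?thesis using that diff by simp
    qed
  qed (use N in auto)
  obtain v where v: "v \<in> H" "v $ 1 = a" using a(1) by auto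
  define s :: "int mat2" where "s = (\<chi> i. if i = 1 then v else axis 2 d)"
  have s: "z v* s = z $ 1 *s v + z $ 2 *s axis 2 d" for z
    by (simp add: s_def vector_matrix_mult_def vec_eq_iff sum_2 mult.commute)
  have "H = range (\<lambda>z. z v* s)"
  proof (intro equalityI subsetI)
    fix h assume h: "h \<in> H"
    obtain k where k: "h $ 1 = a * k" using a(3) h by (auto elim: dvdE)
    have "h - k *s v \<in> H" using diff h v(1) mult by blast
    moreover have "h - k *s v = axis 2 ((h - k *s v) $ 2)"
      using k v by (simp add: vec_eq_iff axis_def forall_2)
    ultimately obtain l where l: "(h - k *s v) $ 2 = d * l" using d(3) by (metis dvdE)
    have "h = (\<chi> i. if i = 1 then k else l) v* s"
      using k l v by (simp add: s vec_eq_iff axis_def forall_2 algebra_simps)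
    then show "h \<in> range (\<lambda>z. z v* s)" by blast
  next
    fix h assume "h \<in> range (\<lambda>z. z v* s)"
    then show "h \<in> H" using add mult v(1) d(1) by (auto simp: s)
  qed
  then show ?thesis using that[of s] v a d by (simp add: s_def axis_def)
qed

text \<open>An intrinsic description that mentions no basis, and so makes stability under sums visible. In
one direction \<open>det s\<close> serves as \<open>N\<close>, by Cramer's rule; in the other a basis comes from the Hermite
form of \<open>N L\<close>.\<close>

lemma superlattices_iff:
  "L \<in> superlattices \<longleftrightarrow> std_lattice \<subseteq> L \<and> (\<forall>x\<in>L. \<forall>y\<in>L. x - y \<in> L) \<and>
     (\<exists>N>0. \<forall>x\<in>L. real N *\<^sub>R x \<in> std_lattice)"
proof
  assume L: "L \<in> superlattices"
  then obtain s where s: "det s > 0" "L = lattice_of s" by (rule superlattice_obtains)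
  have diff: "x - y \<in> L" if "x \<in> L" "y \<in> L" for x y
    using that unfolding s(2) mem_lattice_of[OF s(1)]
    by (simp add: matrix_vector_mult_diff_distrib std_lattice_diff)
  have "real (nat (det s)) *\<^sub>R x \<in> std_lattice" if x: "x \<in> L" for x
  proof -
    let ?S = "int_mat s :: real mat2"
    obtain w where w: "?S *v x = int_vec w"
      using x unfolding s(2) mem_lattice_of[OF s(1)] std_lattice_eq by blast
    \<comment> \<open>Cramer's rule: \<open>det s\<close> times the solution of \<open>s x = w\<close> is \<open>adj s w\<close>\<close>
    have "adjugate2 ?S = int_mat (adjugate2 s)"
      by (simp add: adjugate2_def int_mat_def vec_eq_iff)
    then have "adjugate2 ?S *v (?S *v x) = int_vec (adjugate2 s *v w)"
      unfolding w by (simp add: int_mat_vec)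
    moreover have "adjugate2 ?S *v (?S *v x) = real (nat (det s)) *\<^sub>R x"
      using s(1) unfolding matrix_vector_mul_assoc adjugate2 det_int_mat
      by (simp add: vec_eq_iff forall_2 matrix_vector_mult_def mat_def sum_2)
    ultimately show ?thesis unfolding std_lattice_eq by auto
  qed
  then have "\<exists>N>0. \<forall>x\<in>L. real N *\<^sub>R x \<in> std_lattice"
    using s(1) zero_less_nat_eq by blast
  then show "std_lattice \<subseteq> L \<and> (\<forall>x\<in>L. \<forall>y\<in>L. x - y \<in> L) \<and>
     (\<exists>N>0. \<forall>x\<in>L. real N *\<^sub>R x \<in> std_lattice)"
    using L diff by (auto simp: superlattices_def)
next
  assume "std_lattice \<subseteq> L \<and> (\<forall>x\<in>L. \<forall>y\<in>L. x - y \<in> L) \<and>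
     (\<exists>N>0. \<forall>x\<in>L. real N *\<^sub>R x \<in> std_lattice)"
  then obtain N where L: "std_lattice \<subseteq> L" "\<And>x y. x \<in> L \<Longrightarrow> y \<in> L \<Longrightarrow> x - y \<in> L"
    and N: "N > 0" "\<And>x. x \<in> L \<Longrightarrow> real N *\<^sub>R x \<in> std_lattice" by blast
  define q :: "int^2 \<Rightarrow> real^2" where "q w = (1 / real N) *\<^sub>R int_vec w" for w
  define H where "H = {w. q w \<in> L}"
  have qN: "q (int N *s w) = int_vec w" for w
    using N(1) by (simp add: q_def vec_eq_iff)
  have "q x - q y = q (x - y)" for x y
    by (simp add: q_def vec_eq_iff algebra_simps)
  then have diff: "x - y \<in> H" if "x \<in> H" "y \<in> H" for x y
    using L(2) that unfolding H_def by (metis mem_Collect_eq)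
  have "int N *s w \<in> H" for w
    using L(1) unfolding H_def mem_Collect_eq qN std_lattice_eq by blast
  then obtain s :: "int mat2" where s: "s $ 2 $ 1 = 0" "s $ 1 $ 1 > 0" "s $ 2 $ 2 > 0"
    and H: "H = range (\<lambda>z. z v* s)"
    using hermite_basis[of "int N" H] diff N(1) by (metis of_nat_0_less_iff)
  have L_eq: "L = q ` H"
  proof (intro equalityI subsetI)
    fix x assume x: "x \<in> L"
    then obtain w where w: "real N *\<^sub>R x = int_vec w" using N(2) unfolding std_lattice_eq by blast
    have "x = q w" unfolding q_def w[symmetric] using N(1) by simp
    then show "x \<in> q ` H" using x unfolding H_def by blast
  qed (auto simp: H_def)
  define v w where "v = q (s $ 1)" and "w = q (s $ 2)"
  have vw: "v $ 1 > 0" "w $ 1 = 0" "w $ 2 > 0" using s N(1) by (simp_all add: v_def w_def q_def)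
  have "independent {v, w}"
    using vw by (auto simp: independent_insert span_singleton)
  moreover have "v \<noteq> w" using vw by auto
  moreover have "q (z v* s) = of_int (z $ 1) *\<^sub>R v + of_int (z $ 2) *\<^sub>R w" for z
    by (simp add: q_def v_def w_def vec_eq_iff vector_matrix_mult_def sum_2 algebra_simps add_divide_distrib)
  then have "L = {of_int m *\<^sub>R v + of_int n *\<^sub>R w | m n. True}"
  proof -
    assume q: "\<And>z. q (z v* s) = of_int (z $ 1) *\<^sub>R v + of_int (z $ 2) *\<^sub>R w"
    have "of_int m *\<^sub>R v + of_int n *\<^sub>R w = q ((\<chi> i. if i = 1 then m else n) v* s)" for m n
      unfolding q by simp
    then have "of_int m *\<^sub>R v + of_int n *\<^sub>R w \<in> L" for m n unfolding L_eq H by blast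
    moreover have "\<exists>m n. x = of_int m *\<^sub>R v + of_int n *\<^sub>R w" if "x \<in> L" for x
      using that q unfolding L_eq H by blast
    ultimately show ?thesis by blast
  qed
  ultimately show "L \<in> superlattices"
    using L(1) unfolding superlattices_def is_lattice_def by blast
qed

section \<open>Congruences and units of the profinite integers\<close>

lemma prime_not_dvd_one_zhat:
  assumes "prime p"
  shows "\<not> of_nat p dvd (1::zhat)"
  using assms prime_gt_1_nat[OF assms] by (simp add: prime_dvd_zhat_iff)

lemma zhat_mult_cancel:
  fixes x y :: zhat
  assumes "0 < d" "of_nat d * x = of_nat d * y"
  shows "x = y"
  using of_nat_eq_0_zhat[of d "x - y"] assms by (simp add: right_diff_distrib)

lemma zhat_mult_dvd_cancel:
  fixes x :: zhat
  assumes "0 < d" "of_nat (d * N) dvd of_nat d * x"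
  shows "of_nat N dvd x"
proof -
  obtain k where "of_nat d * x = of_nat d * (of_nat N * k)"
    using assms(2) by (auto simp: dvd_def mult.assoc)
  then have "x = of_nat N * k" by (rule zhat_mult_cancel[OF assms(1)])
  then show ?thesis by simp
qed

lemma prime_zhat_near_int:
  assumes "prime q"
  shows "of_nat q dvd x - (of_int (zhat_residue x q 1) :: zhat)"
  using assms by (simp add: prime_dvd_zhat_iff)

text \<open>\<open>\<int>\<close> is dense in the profinite integers. The induction peels off one prime factor \<open>q\<close> of \<open>N\<close>, the
residue modulo \<open>q\<close> being the last digit.\<close>

lemma ex_int_cong_zhat:
  fixes x :: zhat
  assumes "0 < N"
  shows "\<exists>k. of_nat N dvd x - of_int k"
  using assms
proof (induction N arbitrary: x rule: less_induct)
  case (less N)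
  show ?case
  proof (cases "N = 1")
    case False
    then obtain q where q: "prime q" "q dvd N" using prime_factor_nat by blast
    then obtain e where e: "N = q * e" by (auto elim: dvdE)
    have e': "0 < e" "e < N" using e q(1) less.prems prime_gt_1_nat by auto
    obtain y where y: "x - of_int (zhat_residue x q 1) = of_nat q * y"
      using prime_zhat_near_int[OF q(1)] by (auto elim: dvdE)
    obtain k z where "y - of_int k = of_nat e * z"
      using less.IH[OF e'(2,1), of y] by (auto elim: dvdE)
    then have "y = of_int k + of_nat e * z" by (simp add: algebra_simps)
    then have "x - of_int (zhat_residue x q 1 + int q * k) = of_nat N * z"
      using y by (simp add: e algebra_simps)
    then show ?thesis by (metis dvd_triv_left)
  qed simp
qed

lemma dvd_of_int_zhat:
  assumes "0 < N" "of_nat N dvd (of_int k :: zhat)"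
  shows "int N dvd k"
  using assms
proof (induction N arbitrary: k rule: less_induct)
  case (less N)
  show ?case
  proof (cases "N = 1")
    case False
    then obtain q where q: "prime q" "q dvd N" using prime_factor_nat by blast
    then obtain e where e: "N = q * e" by (auto elim: dvdE)
    have e': "0 < e" "e < N" using e q(1) less.prems prime_gt_1_nat by auto
    have "of_nat q dvd (of_int k :: zhat)" using less.prems(2) unfolding e by (auto elim: dvdE)
    then have "int q dvd k" using q(1) by (simp add: prime_dvd_zhat_iff mod_eq_0_iff_dvd)
    then obtain l where l: "k = int q * l" by (auto elim: dvdE)
    have "of_nat e dvd (of_int l :: zhat)"
      using less.prems(2) prime_gt_0_nat[OF q(1)] zhat_mult_dvd_cancel[of q e "of_int l"]
      by (simp add: e l)
    then show ?thesis using less.IH[OF e'(2,1)] by (simp add: e l)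
  qed simp
qed

text \<open>Each residue of \<open>x\<close> modulo \<open>p ^ n\<close> is a unit because the one modulo \<open>p\<close> is nonzero, and inverses
modulo \<open>p ^ n\<close> are unique, hence coherent in \<open>n\<close>.\<close>

lemma zhat_unit:
  assumes "\<And>p. prime p \<Longrightarrow> \<not> of_nat p dvd (x::zhat)"
  shows "\<exists>y. x * y = 1"
proof -
  have cop: "coprime (zhat_residue x p n) (int p ^ n)" if p: "prime p" for p n
  proof (cases n)
    case (Suc m)
    have "zhat_residue x p (Suc k) mod int p = zhat_residue x p 1" for k
    proof (induction k)
      case (Suc k)
      have "zhat_residue x p (Suc (Suc k)) mod int p ^ Suc k mod int p = zhat_residue x p (Suc (Suc k)) mod int p"
        by (rule mod_mod_cancel) simp
      then show ?case using Suc zhat_residue_Suc[OF p, of x "Suc k"] by (simp del: power_Suc)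
    qed (use zhat_residue_mod[OF p, of x 1] in simp)
    then have "\<not> int p dvd zhat_residue x p n"
      using assms[OF p] p by (simp add: Suc prime_dvd_zhat_iff dvd_eq_mod_eq_0)
    then have "coprime (int p) (zhat_residue x p n)"
      using p by (simp add: prime_imp_coprime)
    then show ?thesis by (simp add: coprime_commute)
  qed simp
  have "\<exists>r. int p ^ n dvd zhat_residue x p n * r - 1" if p: "prime p" for p n
  proof -
    obtain u v where "u * zhat_residue x p n + v * int p ^ n = 1"
      using bezout_int[of "zhat_residue x p n" "int p ^ n"] cop[OF p]
      by (metis coprime_imp_gcd_eq_1)
    then have "zhat_residue x p n * u - 1 = int p ^ n * (- v)" by (simp add: algebra_simps)
    then show ?thesis by (metis dvd_triv_left)
  qed
  then obtain r where r: "\<And>p n. prime p \<Longrightarrow> int p ^ n dvd zhat_residue x p n * r p n - 1" by metis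
  have "r p (Suc n) mod int p ^ n = r p n mod int p ^ n" if p: "prime p" for p n
  proof -
    have "int p ^ n dvd zhat_residue x p (Suc n) * r p (Suc n) - 1"
      using r[OF p, of "Suc n"] by (rule dvd_trans[rotated]) simp
    moreover have "int p ^ n dvd zhat_residue x p (Suc n) - zhat_residue x p n"
      using zhat_residue_Suc[OF p, of x n] zhat_residue_mod[OF p, of x n]
      by (metis mod_eq_dvd_iff)
    ultimately have "int p ^ n dvd (zhat_residue x p (Suc n) * r p (Suc n) - 1)
        - (zhat_residue x p (Suc n) - zhat_residue x p n) * r p (Suc n)
        - (zhat_residue x p n * r p n - 1)"
      using r[OF p, of n] by (meson dvd_diff dvd_mult2)
    then have "int p ^ n dvd zhat_residue x p n * (r p (Suc n) - r p n)"
      by (simp add: algebra_simps)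
    then show ?thesis
      using cop[OF p, of n] by (simp add: mod_eq_dvd_iff coprime_dvd_mult_right_iff coprime_commute)
  qed
  then have "zhat_residue (zhat_of r) p n = r p n mod int p ^ n" if "prime p" for p n
    using that by (intro zhat_residue_zhat_of)
  then have "x * zhat_of r = 1"
    using r by (intro zhat_eqI) (simp add: mod_simps mod_eq_dvd_iff)
  then show ?thesis by blast
qed

text \<open>Chinese remaindering over all primes at once, which a product over the primes allows.\<close>

lemma ex_zhat_residues_mod_primes:
  fixes t :: "nat \<Rightarrow> zhat"
  shows "\<exists>x. \<forall>p. prime p \<longrightarrow> zhat_residue x p 1 = zhat_residue (t p) p 1"
proof -
  have "zhat_residue (zhat_of (\<lambda>p. zhat_residue (t p) p)) p 1 = zhat_residue (t p) p 1"
    if p: "prime p" for p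
  proof -
    have "zhat_residue (zhat_of (\<lambda>p. zhat_residue (t p) p)) p 1 = zhat_residue (t p) p 1 mod int p ^ 1"
      by (rule zhat_residue_zhat_of[OF _ p]) (simp add: zhat_residue_Suc)
    then show ?thesis using zhat_residue_mod[OF p, of "t p" 1] by simp
  qed
  then show ?thesis by blast
qed

lemma invertible_zhat_mat:
  fixes g :: "zhat mat2"
  assumes "\<And>p. prime p \<Longrightarrow> \<not> of_nat p dvd det g"
  shows "invertible g"
proof -
  obtain y where y: "det g * y = 1" using zhat_unit assms by blast
  have "(g ** adjugate2 g) ** mat y = mat 1" "mat y ** (adjugate2 g ** g) = mat 1"
    unfolding adjugate2 using y
    by (simp_all add: vec_eq_iff matrix_matrix_mult_def mat_def sum_2 forall_2 mult.commute)
  moreover have "mat y ** adjugate2 g = adjugate2 g ** mat y"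
    by (simp add: vec_eq_iff mat_mult_2 mult.commute)
  ultimately have "g ** (adjugate2 g ** mat y) = mat 1" "(adjugate2 g ** mat y) ** g = mat 1"
    by (simp_all add: matrix_mul_assoc)
  then show ?thesis unfolding invertible_def by blast
qed

lemma matrix_mult_add_left: "(A + B) ** C = A ** C + B ** (C :: 'a::semiring_1 mat2)"
  by (simp add: vec_eq_iff matrix_matrix_mult_def sum.distrib distrib_right)

lemma det_cong_dvd:
  fixes A B :: "'a::comm_ring_1 mat2"
  assumes "\<And>i j. d dvd A $ i $ j - B $ i $ j"
  shows "d dvd det A - det B"
proof -
  have "det A - det B = (A $ 1 $ 1 - B $ 1 $ 1) * A $ 2 $ 2 + B $ 1 $ 1 * (A $ 2 $ 2 - B $ 2 $ 2)
      - ((A $ 1 $ 2 - B $ 1 $ 2) * A $ 2 $ 1 + B $ 1 $ 2 * (A $ 2 $ 1 - B $ 2 $ 1))"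
    by (simp add: det_2 algebra_simps)
  also have "d dvd \<dots>"
    using assms by simp
  finally show ?thesis .
qed

text \<open>Modulo \<open>p\<close> the matrix \<open>T\<close> can be \<open>0\<close>, an elementary matrix or the identity. If \<open>det Y\<close> is
nonzero modulo \<open>p\<close>, take \<open>T = 0\<close>. Otherwise adding an elementary multiple of \<open>C\<close> changes the determinant by an
entry of \<open>C adj Y\<close>. If all these entries vanish modulo \<open>p\<close>, then multiplying \<open>X Y + C = 1\<close> by \<open>adj Y\<close>
gives \<open>adj Y = X det Y + C adj Y = 0\<close>, so \<open>Y = 0\<close> and \<open>C = 1\<close> modulo \<open>p\<close>.\<close>

lemma stable_range_prime:
  fixes X Y C :: "zhat mat2"
  assumes one: "X ** Y + C = mat 1" and p: "prime p"
  shows "\<exists>T. \<not> of_nat p dvd det (Y + T ** C)"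
proof (cases "of_nat p dvd det Y")
  case False
  moreover have "Y + 0 ** C = Y" by (simp add: vec_eq_iff matrix_matrix_mult_def)
  ultimately show ?thesis by metis
next
  case True
  show ?thesis
  proof (cases "\<forall>i j. of_nat p dvd (C ** adjugate2 Y) $ i $ j")
    case False
    then obtain i j where ij: "\<not> of_nat p dvd (C ** adjugate2 Y) $ i $ j" by blast
    \<comment> \<open>the elementary matrix that picks out the \<open>(i, j)\<close> entry of \<open>C adj Y\<close>\<close>
    define T :: "zhat mat2" where "T = (\<chi> k l. if k = j \<and> l = i then 1 else 0)"
    have "det (Y + T ** C) = det Y + (C ** adjugate2 Y) $ i $ j"
    proof -
      consider "i = 1" "j = 1" | "i = 1" "j = 2" | "i = 2" "j = 1" | "i = 2" "j = 2"
        using exhaust_2[of i] exhaust_2[of j] by blast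
      then show ?thesis
by cases (simp_all add: T_def det_2 matrix_matrix_mult_def adjugate2_def sum_2 algebra_simps)
    qed
    then show ?thesis using True ij by (metis dvd_add_right_iff)
  next
    case all: True
    have "adjugate2 Y = (X ** Y + C) ** adjugate2 Y" by (simp add: one)
    also have "\<dots> = X ** (Y ** adjugate2 Y) + C ** adjugate2 Y"
      by (simp add: matrix_mult_add_left matrix_mul_assoc)
    also have "\<dots> = X ** mat (det Y) + C ** adjugate2 Y" by (simp add: adjugate2)
    finally have "adjugate2 Y $ i $ j = X $ i $ j * det Y + (C ** adjugate2 Y) $ i $ j" for i j
      by (metis mat_mult_2(1) vector_add_component)
    then have "of_nat p dvd adjugate2 Y $ i $ j" for i j
      using True all by simp
    from this[of 1 1] this[of 1 2] this[of 2 1] this[of 2 2]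
    have Y: "of_nat p dvd Y $ i $ j" for i j
      using exhaust_2[of i] exhaust_2[of j] by (auto simp: adjugate2_def)
    have C: "C = mat 1 - X ** Y" using one by (simp add: algebra_simps)
    have "of_nat p dvd (Y + mat 1 ** C) $ i $ j - (mat 1 :: zhat mat2) $ i $ j" for i j
      using Y by (simp add: C) (simp add: matrix_matrix_mult_def sum_2)
    then have "of_nat p dvd det (Y + mat 1 ** C) - det (mat 1 :: zhat mat2)"
      by (rule det_cong_dvd)
    then have "of_nat p dvd det (Y + mat 1 ** C) - 1"
      by simp
    then have "\<not> of_nat p dvd det (Y + mat 1 ** C)"
      using prime_not_dvd_one_zhat[OF p] by (metis dvd_diff diff_diff_eq2 add_diff_cancel_left')
    then show ?thesis by blast
  qed
qed

text \<open>The ring of \<open>2 \<times> 2\<close> matrices has stable range one. Since invertibility only depends on the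
determinant modulo every prime, the local choices of \<open>T\<close> can be combined.\<close>

lemma stable_range:
  fixes X Y C :: "zhat mat2"
  assumes "X ** Y + C = mat 1"
  shows "\<exists>T. invertible (Y + T ** C)"
proof -
  obtain T where T: "\<And>p. prime p \<Longrightarrow> \<not> of_nat p dvd det (Y + T p ** C)"
    using stable_range_prime[OF assms] by metis
  define t where "t i j = (SOME x. \<forall>p. prime p \<longrightarrow> zhat_residue x p 1 = zhat_residue (T p $ i $ j) p 1)"
    for i j
  have t: "zhat_residue (t i j) p 1 = zhat_residue (T p $ i $ j) p 1" if "prime p" for i j p
    using someI_ex[OF ex_zhat_residues_mod_primes[of "\<lambda>p. T p $ i $ j"]] that unfolding t_def by blast
  have "\<not> of_nat p dvd det (Y + (\<chi> i j. t i j) ** C)" if p: "prime p" for p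
  proof
    have dvd: "of_nat p dvd t i j - T p $ i $ j" for i j
      using p t[OF p, of i j] by (simp add: prime_dvd_zhat_iff)
    have "of_nat p dvd (Y + (\<chi> i j. t i j) ** C) $ i $ j - (Y + T p ** C) $ i $ j" for i j
    proof -
      have "(Y + (\<chi> i j. t i j) ** C) $ i $ j - (Y + T p ** C) $ i $ j =
          (t i 1 - T p $ i $ 1) * C $ 1 $ j + (t i 2 - T p $ i $ 2) * C $ 2 $ j"
        by (simp add: matrix_matrix_mult_def sum_2 algebra_simps)
      then show ?thesis using dvd by simp
    qed
    then have "of_nat p dvd det (Y + (\<chi> i j. t i j) ** C) - det (Y + T p ** C)"
      by (rule det_cong_dvd)
    moreover assume "of_nat p dvd det (Y + (\<chi> i j. t i j) ** C)"
    ultimately have "of_nat p dvd det (Y + T p ** C)"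
      by (metis dvd_diff diff_diff_eq2 add_diff_cancel_left')
    then show False using T[OF p] by blast
  qed
  then show ?thesis using invertible_zhat_mat by blast
qed

section \<open>Star homomorphisms on the algebra of invariant functions\<close>

lemma scaleC_one [simp]: "1 *\<^sub>C x = (x::'a::cstar_algebra)"
  using scaleR_scaleC[of 1 x] by simp

lemma scaleC_zero_left [simp]: "0 *\<^sub>C x = (0::'a::cstar_algebra)"
  using scaleR_scaleC[of 0 x] by simp

lemma scaleC_minus_one: "(-1) *\<^sub>C x = - (x::'a::cstar_algebra)"
  using scaleR_scaleC[of "-1" x] by simp

lemma scaleC_zero_right [simp]: "c *\<^sub>C 0 = (0::'a::cstar_algebra)"
  using scaleC_add_right[of c 0 "0::'a"] by simp

lemma scaleC_sum_right: "c *\<^sub>C (\<Sum>i\<in>I. g i) = (\<Sum>i\<in>I. c *\<^sub>C (g i :: 'a::cstar_algebra))"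
  by (induction I rule: infinite_finite_induct) (simp_all add: scaleC_add_right)

lemma star_zero [simp]: "star 0 = (0::'a::cstar_algebra)"
  using star_add[of 0 "0::'a"] by simp

lemma star_diff: "star (x - y) = star x - star (y::'a::cstar_algebra)"
  using star_add[of "x - y" y] by simp

lemma star_sum: "star (\<Sum>i\<in>I. g i) = (\<Sum>i\<in>I. star (g i :: 'a::cstar_algebra))"
  by (induction I rule: infinite_finite_induct) (simp_all add: star_add)

text \<open>The C*-identity gives \<open>\<parallel>x\<parallel>\<^sup>2 \<le> \<parallel>x\<^sup>*\<parallel> \<parallel>x\<parallel>\<close>, and the argument is symmetric in \<open>x\<close> and \<open>x\<^sup>*\<close>.\<close>

lemma norm_star: "norm (star x) = norm (x::'a::cstar_algebra)"
proof -
  have le: "norm y \<le> norm (star y)" for y :: 'a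
  proof (cases "norm y = 0")
    case False
    have "norm y * norm y \<le> norm (star y) * norm y"
      using norm_star_mult_self[of y] norm_mult_ineq[of "star y" y] by (simp add: power2_eq_square)
    then show ?thesis using False by (simp add: mult_le_cancel_right)
  qed simp
  show ?thesis using le[of x] le[of "star x"] by (simp add: star_star)
qed

lemma norm_projection_le_1:
  assumes "projection p"
  shows "norm p \<le> 1"
proof -
  have "norm p * norm p = norm p"
    using norm_star_mult_self[of p] assms by (simp add: projection_def power2_eq_square)
  then show ?thesis by (cases "norm p = 0") auto
qed

lemma star_hom_diff:
  assumes "star_hom \<psi>"
  shows "\<psi> (x - y) = \<psi> x - \<psi> y"
proof -
  have "\<psi> (x + (-1) *\<^sub>C y) = \<psi> x + (-1) *\<^sub>C \<psi> y" using assms unfolding star_hom_def by metis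
  then show ?thesis by (simp add: scaleC_minus_one)
qed

text \<open>A real function \<open>h\<close> with values in \<open>[-1, 1]\<close> is the real part of the unitary
\<open>u = h + i sqrt (1 - h\<^sup>2)\<close>. The image of \<open>u\<close> has norm at most one by the C*-identity, since
\<open>u\<^sup>* u = 1\<close> is mapped to a projection. This replaces the usual argument with spectral radii.\<close>

lemma star_hom_norm_le_selfadjoint:
  fixes \<psi> :: "inv_fun \<Rightarrow> 'b::cstar_algebra"
  assumes \<psi>: "star_hom \<psi>" and h: "star h = h" "norm h \<le> 1"
  shows "norm (\<psi> h) \<le> 1"
proof -
  define r where "r A = Re (app_inv_fun h A)" for A
  have hr: "app_inv_fun h A = of_real (r A)" for A
    using arg_cong[OF h(1), of "\<lambda>f. app_inv_fun f A"] by (simp add: r_def complex_eq_iff)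
  have r1: "(r A)\<^sup>2 \<le> 1" for A
    using cmod_le_norm_inv_fun[of h A] h(2) by (simp add: hr abs_square_le_1)
  have "app_inv_fun h (g ** A) = app_inv_fun h A" if "invertible g" for g A
    using app_inv_fun[of h] that by simp
  moreover have "continuous_on UNIV (\<lambda>A. complex_of_real (sqrt (1 - (Re (app_inv_fun h A))\<^sup>2)))"
    by (intro continuous_intros continuous_on_inv_fun)
  ultimately obtain k where k: "\<And>A. app_inv_fun k A = of_real (sqrt (1 - (r A)\<^sup>2))"
    using Abs_inv_fun_inverse[of "\<lambda>A. of_real (sqrt (1 - (r A)\<^sup>2))"]
    by (simp add: r_def) metis
  obtain e where e: "\<And>A. app_inv_fun e A = 1"
    using Abs_inv_fun_inverse[of "\<lambda>_. 1"] by simp metis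
  \<comment> \<open>unitary with real part \<open>h\<close>\<close>
  define u where "u = h + \<i> *\<^sub>C k"
  have "star u * u = e"
    using r1 by (intro inv_fun_eqI)
      (simp add: u_def hr k e complex_eq_iff power2_eq_square[symmetric])
  have "projection (\<psi> e)"
  proof -
    have "e * e = e" "star e = e" by (intro inv_fun_eqI; simp add: e)+
    then show ?thesis using \<psi> unfolding projection_def star_hom_def by metis
  qed
  then have "norm (\<psi> (star u * u)) \<le> 1"
    unfolding \<open>star u * u = e\<close> by (rule norm_projection_le_1)
  then have "(norm (\<psi> u))\<^sup>2 \<le> 1"
    using \<psi> unfolding star_hom_def by (metis norm_star_mult_self)
  then have u: "norm (\<psi> u) \<le> 1" by (simp add: abs_square_le_1)
  have "(1/2) *\<^sub>C (u + star u) = h"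
    by (intro inv_fun_eqI) (simp add: u_def hr k complex_eq_iff)
  then have "\<psi> h = (1/2) *\<^sub>C (\<psi> u + star (\<psi> u))"
    using \<psi> unfolding star_hom_def by metis
  then have "norm (\<psi> h) = (1/2) * norm (\<psi> u + star (\<psi> u))"
    by (simp add: norm_scaleC)
  also have "\<dots> \<le> (1/2) * (1 + 1)"
    using u norm_triangle_ineq[of "\<psi> u" "star (\<psi> u)"] by (simp add: norm_star)
  finally show ?thesis by simp
qed

text \<open>The C*-identity reduces the claim to the self-adjoint element \<open>f\<^sup>* f\<close>, scaled to norm one.\<close>

lemma star_hom_norm_le:
  fixes \<psi> :: "inv_fun \<Rightarrow> 'b::cstar_algebra"
  assumes \<psi>: "star_hom \<psi>"
  shows "norm (\<psi> f) \<le> norm f"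
proof (cases "f = 0")
  case True
  then show ?thesis using star_hom_diff[OF \<psi>, of 0 0] by simp
next
  case False
  \<comment> \<open>scales \<open>f\<^sup>* f\<close>, whose norm is \<open>(norm f)\<^sup>2\<close>, to norm one\<close>
  define c where "c = complex_of_real (1 / (norm f)\<^sup>2)"
  define h where "h = c *\<^sub>C (star f * f)"
  have "norm h = 1" using False by (simp add: h_def c_def norm_scaleC norm_star_mult_self norm_divide norm_power)
  moreover have "star h = h" by (simp add: h_def c_def star_scaleC star_mult star_star)
  ultimately have "norm (\<psi> h) \<le> 1" using star_hom_norm_le_selfadjoint[OF \<psi>] by simp
  moreover have "\<psi> h = c *\<^sub>C (star (\<psi> f) * \<psi> f)"
    using \<psi> unfolding star_hom_def h_def by metis
  ultimately have "(norm (\<psi> f))\<^sup>2 / (norm f)\<^sup>2 \<le> 1"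
    by (simp add: norm_scaleC norm_star_mult_self c_def norm_divide norm_power)
  then have "(norm (\<psi> f))\<^sup>2 \<le> (norm f)\<^sup>2" using False by (simp add: divide_le_eq)
  then show ?thesis by (rule power2_le_imp_le) simp
qed

section \<open>Minimal projections of a finite semilattice of projections\<close>

text \<open>The Moebius inversion of \<open>\<rho>\<close>: the part of \<open>\<rho> L\<close> that belongs to no larger element of \<open>P\<close>. Written
recursively, it avoids the product of the \<open>1 - \<rho> M\<close>, for which an algebra without unit has no
room. The value \<open>0\<close> for infinite \<open>P\<close> makes the recursion terminate.\<close>

function atom :: "'i::order set \<Rightarrow> ('i \<Rightarrow> 'a::ab_group_add) \<Rightarrow> 'i \<Rightarrow> 'a" where
  "atom P \<rho> L = (if finite P then \<rho> L - (\<Sum>M\<in>{M\<in>P. L < M}. atom P \<rho> M) else 0)"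
  by auto
termination
  by (relation "Wellfounded.measure (\<lambda>(P, \<rho>, L). card {M\<in>P. L < M})")
    (auto intro!: psubset_card_mono)

declare atom.simps [simp del]

text \<open>The operation \<open>join\<close> is not the supremum of the type class of \<open>'i\<close> because the intended one is the
sum of two lattices, which is their supremum among lattices but not among sets of vectors.\<close>

locale projection_semilattice =
  fixes P :: "'i::order set" and join :: "'i \<Rightarrow> 'i \<Rightarrow> 'i" and \<rho> :: "'i \<Rightarrow> 'a::cstar_algebra"
  assumes finite_P: "finite P"
    and join_in: "L \<in> P \<Longrightarrow> M \<in> P \<Longrightarrow> join L M \<in> P"
    and join_le_iff: "L \<in> P \<Longrightarrow> M \<in> P \<Longrightarrow> K \<in> P \<Longrightarrow> join L M \<le> K \<longleftrightarrow> L \<le> K \<and> M \<le> K"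
    and mult_join: "L \<in> P \<Longrightarrow> M \<in> P \<Longrightarrow> \<rho> L * \<rho> M = \<rho> (join L M)"
    and star_rho: "L \<in> P \<Longrightarrow> star (\<rho> L) = \<rho> L"
begin

abbreviation e :: "'i \<Rightarrow> 'a" where "e \<equiv> atom P \<rho>"

lemma atom_eq: "e L = \<rho> L - (\<Sum>M\<in>{M\<in>P. L < M}. e M)"
  using finite_P by (subst atom.simps) simp

lemma sum_atoms_above:
  assumes "L \<in> P"
  shows "(\<Sum>M\<in>{M\<in>P. L \<le> M}. e M) = \<rho> L"
proof -
  have "{M\<in>P. L \<le> M} = insert L {M\<in>P. L < M}" using assms by auto
  then have "(\<Sum>M\<in>{M\<in>P. L \<le> M}. e M) = e L + (\<Sum>M\<in>{M\<in>P. L < M}. e M)"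
    using finite_P by simp
  then show ?thesis by (simp add: atom_eq[of L])
qed

lemma descend_induct [consumes 1, case_names step]:
  assumes "M \<in> P" and "\<And>M. M \<in> P \<Longrightarrow> (\<And>K. K \<in> P \<Longrightarrow> M < K \<Longrightarrow> Q K) \<Longrightarrow> Q M"
  shows "Q M"
  using assms(1)
proof (induction "card {K\<in>P. M < K}" arbitrary: M rule: less_induct)
  case less
  have "Q K" if "K \<in> P" "M < K" for K
  proof (rule less.hyps[OF _ that(1)])
    show "card {J\<in>P. K < J} < card {K\<in>P. M < K}"
      using that finite_P by (intro psubset_card_mono) auto
  qed
  then show ?case using assms(2) less.prems by blast
qed

text \<open>Orthogonality comes from comparing two expansions: if \<open>L\<close> is not below \<open>M\<close>, then the elements
strictly above \<open>M\<close> and above \<open>L\<close> are those above \<open>join L M\<close>, whose atoms add up to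
\<open>\<rho> (join L M) = \<rho> L \<rho> M\<close>.\<close>

lemma rho_mult_atom:
  assumes "M \<in> P" "L \<in> P"
  shows "\<rho> L * e M = (if L \<le> M then e M else 0)"
  using assms
proof (induction M rule: descend_induct)
  case (step M)
  have "\<rho> L * e M = \<rho> (join L M) - (\<Sum>K\<in>{K\<in>P. M < K}. \<rho> L * e K)"
    using step.prems step.hyps by (simp add: atom_eq[of M] right_diff_distrib mult_join sum_distrib_left)
  also have "(\<Sum>K\<in>{K\<in>P. M < K}. \<rho> L * e K) = (\<Sum>K\<in>{K\<in>P. M < K}. if L \<le> K then e K else 0)"
    using step by (intro sum.cong) auto
  also have "\<dots> = (\<Sum>K\<in>{K\<in>P. M < K \<and> L \<le> K}. e K)"
    using finite_P by (simp add: sum.inter_filter[symmetric] conj_assoc)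
  finally have *: "\<rho> L * e M = \<rho> (join L M) - (\<Sum>K\<in>{K\<in>P. M < K \<and> L \<le> K}. e K)" .
  show ?case
  proof (cases "L \<le> M")
    case True
    then have "join L M = M"
      using join_le_iff[OF step.prems step.hyps(1), of M] join_in[OF step.prems step.hyps(1)]
        join_le_iff[OF step.prems step.hyps(1), of "join L M"] step.hyps(1) by auto
    moreover have "{K\<in>P. M < K \<and> L \<le> K} = {K\<in>P. M < K}" using True by auto
    ultimately show ?thesis using * True by (simp add: atom_eq[of M])
  next
    case False
    then have "{K\<in>P. M < K \<and> L \<le> K} = {K\<in>P. join L M \<le> K}"
      using join_le_iff[OF step.prems step.hyps(1)] by (auto simp: order_less_le)
    then show ?thesis
      using * False sum_atoms_above[OF join_in[OF step.prems step.hyps(1)]] by simp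
  qed
qed

lemma atom_mult_atom:
  assumes "L \<in> P" "M \<in> P"
  shows "e L * e M = (if L = M then e M else 0)"
  using assms
proof (induction L rule: descend_induct)
  case (step L)
  have "e L * e M = \<rho> L * e M - (\<Sum>K\<in>{K\<in>P. L < K}. e K * e M)"
    by (simp add: atom_eq[of L] left_diff_distrib sum_distrib_right)
  also have "(\<Sum>K\<in>{K\<in>P. L < K}. e K * e M) = (\<Sum>K\<in>{K\<in>P. L < K}. if K = M then e M else 0)"
    using step by (intro sum.cong) auto
  also have "\<dots> = (if L < M then e M else 0)"
    using finite_P step.prems by simp
  finally show ?case
    using rho_mult_atom[OF step.prems step.hyps(1)] by (auto simp: order_less_le)
qed

lemma star_atom:
  assumes "L \<in> P"
  shows "star (e L) = e L"
  using assms
proof (induction L rule: descend_induct)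
  case (step L)
  then show ?case by (simp add: atom_eq[of L] star_diff star_sum star_rho)
qed

text \<open>Sampling at finitely many points and using the samples as coefficients of orthogonal projections is
multiplicative.\<close>

lemma star_hom_atom_sum:
  "star_hom (\<lambda>f. \<Sum>M\<in>P. app_inv_fun f (x M) *\<^sub>C e M)"
proof -
  let ?\<phi> = "\<lambda>f. \<Sum>M\<in>P. app_inv_fun f (x M) *\<^sub>C e M"
  have "?\<phi> f * ?\<phi> g = ?\<phi> (f * g)" for f g
  proof -
    have "?\<phi> f * ?\<phi> g = (\<Sum>M\<in>P. \<Sum>K\<in>P. (app_inv_fun f (x M) * app_inv_fun g (x K)) *\<^sub>C (e M * e K))"
      unfolding sum_product
      by (intro sum.cong) (simp_all add: mult_scaleC_left mult_scaleC_right scaleC_scaleC mult.commute)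
    also have "\<dots> = (\<Sum>M\<in>P. \<Sum>K\<in>P. if K = M then app_inv_fun (f * g) (x M) *\<^sub>C e M else 0)"
      by (intro sum.cong) (auto simp: atom_mult_atom)
    also have "\<dots> = ?\<phi> (f * g)" using finite_P by simp
    finally show ?thesis .
  qed
  moreover have "?\<phi> (star f) = star (?\<phi> f)" for f
    unfolding star_sum by (intro sum.cong) (simp_all add: star_scaleC star_atom)
  ultimately show ?thesis
    unfolding star_hom_def
    by (simp add: scaleC_add_left sum.distrib scaleC_sum_right scaleC_scaleC)
qed

end

section \<open>Left ideals as integrality conditions on lattices\<close>

lemma zhat_mat_vec_int:
  "(int_mat t *v int_vec w) $ i = (of_int ((t *v w) $ i) :: zhat)"
  by (simp add: int_mat_vec)

lemma mat_vec_scale: "A *v (c *s x) = c *s (A *v (x :: 'a::comm_ring_1^2))"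
  by (simp add: vec_eq_iff matrix_vector_mult_def sum_distrib_left algebra_simps)

text \<open>This says that \<open>A\<close> maps \<open>L\<close> into the integral vectors. A rational vector cannot be multiplied by a
profinite matrix directly, so it is represented as \<open>w / N\<close>, and integrality of \<open>A w / N\<close> becomes
divisibility of \<open>A w\<close> by \<open>N\<close>.\<close>

definition integral_on :: "zhat mat2 \<Rightarrow> (real^2) set \<Rightarrow> bool" where
  "integral_on A L \<longleftrightarrow>
     (\<forall>N>0. \<forall>w. (1 / real N) *\<^sub>R int_vec w \<in> L \<longrightarrow> (\<forall>i. of_nat N dvd (A *v int_vec w) $ i))"

lemma integral_onD:
  "integral_on A L \<Longrightarrow> 0 < N \<Longrightarrow> (1 / real N) *\<^sub>R int_vec w \<in> L \<Longrightarrow> of_nat N dvd (A *v int_vec w) $ i"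
  unfolding integral_on_def by blast

text \<open>If \<open>A = B s\<close> then \<open>A s\<^sup>-\<^sup>1 \<int>\<^sup>2 = B \<int>\<^sup>2\<close> is integral. Conversely, it suffices to test \<open>A\<close> on the
generators of the lattice, the columns of \<open>s\<^sup>-\<^sup>1 = adj s / det s\<close>.\<close>

lemma left_ideal_iff_integral_on:
  assumes s: "det s > 0"
  shows "A \<in> left_ideal s \<longleftrightarrow> integral_on A (lattice_of s)"
proof
  assume "A \<in> left_ideal s"
  then obtain B where A: "A = B ** int_mat s" unfolding left_ideal_def by blast
  show "integral_on A (lattice_of s)"
    unfolding integral_on_def
  proof (intro allI impI)
    fix N w i assume N: "0 < N" and "(1 / real N) *\<^sub>R int_vec w \<in> lattice_of s"
    then obtain z where "int_mat s *v ((1 / real N) *\<^sub>R int_vec w) = (int_vec z :: real^2)"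
      unfolding mem_lattice_of[OF s] std_lattice_eq by blast
    then have "(1 / real N) *\<^sub>R int_vec (s *v w) = (int_vec z :: real^2)"
      by (simp add: matrix_vector_mult_scaleR int_mat_vec)
    then have "real_of_int ((s *v w) $ j) = real_of_int (int N * z $ j)" for j
      using N by (simp add: vec_eq_iff field_simps)
    then have "(s *v w) $ j = int N * z $ j" for j
      using of_int_eq_iff by blast
    then have "int_vec (s *v w) = of_nat N *s (int_vec z :: zhat^2)"
      by (simp add: vec_eq_iff)
    then have "A *v int_vec w = of_nat N *s (B *v int_vec z)"
      unfolding A by (simp add: int_mat_vec mat_vec_scale flip: matrix_vector_mul_assoc)
    then show "of_nat N dvd (A *v int_vec w) $ i" by simp
  qed
next
  assume int: "integral_on A (lattice_of s)"
  let ?N = "nat (det s)"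
  have "of_nat ?N dvd (A ** adjugate2 (int_mat s)) $ i $ j" for i j
  proof -
    \<comment> \<open>\<open>w / det s\<close> is the \<open>j\<close>-th column of \<open>s\<^sup>-\<^sup>1\<close>, a member of the lattice\<close>
    define w where "w = column j (adjugate2 s)"
    have "s *v w = column j (s ** adjugate2 s)"
      by (simp add: w_def column_def matrix_vector_mult_def matrix_matrix_mult_def)
    then have sw: "s *v w = det s *s axis j 1"
      by (simp add: adjugate2 column_def vec_eq_iff mat_def axis_def)
    have "int_mat s *v ((1 / real ?N) *\<^sub>R int_vec w) = (int_vec (axis j 1) :: real^2)"
      using s by (simp add: matrix_vector_mult_scaleR int_mat_vec sw vec_eq_iff axis_def)
    then have "(1 / real ?N) *\<^sub>R int_vec w \<in> lattice_of s"
      unfolding mem_lattice_of[OF s] std_lattice_eq by (metis rangeI)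
    then have "of_nat ?N dvd (A *v int_vec w) $ i"
      using s by (intro integral_onD[OF int]) simp_all
    moreover have "int_vec w $ k = adjugate2 (int_mat s :: zhat mat2) $ k $ j" for k
      by (simp add: w_def column_def adjugate2_def int_mat_def)
    ultimately show ?thesis
      by (simp add: matrix_vector_mult_def matrix_matrix_mult_def)
  qed
  then show "A \<in> left_ideal s" unfolding left_ideal_iff[OF s] by blast
qed

lemma app_lattice_proj_superlattice:
  assumes "L \<in> superlattices"
  shows "app_inv_fun (lattice_proj L) A = (if integral_on A L then 1 else 0)"
proof -
  obtain s where "det s > 0" "L = lattice_of s" using assms by (rule superlattice_obtains)
  then show ?thesis by (simp add: app_lattice_proj left_ideal_iff_integral_on indicator_def)
qed

lemma integral_on_mono: "integral_on A L' \<Longrightarrow> L \<subseteq> L' \<Longrightarrow> integral_on A L"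
  unfolding integral_on_def by blast

lemma superlattice_zero: "L \<in> superlattices \<Longrightarrow> 0 \<in> L"
  unfolding superlattices_iff by (auto simp: std_lattice_def)

lemma superlattice_diff: "L \<in> superlattices \<Longrightarrow> x \<in> L \<Longrightarrow> y \<in> L \<Longrightarrow> x - y \<in> L"
  unfolding superlattices_iff by blast

lemma std_lattice_subset: "L \<in> superlattices \<Longrightarrow> std_lattice \<subseteq> L"
  unfolding superlattices_iff by blast

lemma superlattice_rational:
  assumes "L \<in> superlattices" "x \<in> L"
  obtains D w where "D > 0" "x = (1 / real D) *\<^sub>R int_vec w"
proof -
  obtain N where N: "N > 0" "real N *\<^sub>R x \<in> std_lattice"
    using assms unfolding superlattices_iff by blast
  then obtain w where w: "real N *\<^sub>R x = int_vec w" unfolding std_lattice_eq by blast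
  then have "(1 / real N) *\<^sub>R (real N *\<^sub>R x) = (1 / real N) *\<^sub>R int_vec w" by (rule arg_cong)
  then have "x = (1 / real N) *\<^sub>R int_vec w" using N(1) by simp
  then show ?thesis using that N(1) by blast
qed

lemma scaleR_plus_in_std_lattice:
  assumes N: "\<And>x. x \<in> L \<Longrightarrow> real N *\<^sub>R x \<in> std_lattice" "\<And>x. x \<in> L' \<Longrightarrow> real N *\<^sub>R x \<in> std_lattice"
    and "z \<in> L + L'"
  shows "real N *\<^sub>R z \<in> std_lattice"
proof -
  obtain x y where "x \<in> L" "y \<in> L'" "z = x + y" using assms(3) by (auto simp: set_plus_def)
  then show ?thesis using N(1)[of x] N(2)[of y] by (simp add: scaleR_right_distrib std_lattice_def distrib_left)
qed

lemma subset_plus: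
  assumes "L \<in> superlattices" "L' \<in> superlattices"
  shows "L \<subseteq> L + L'" "L' \<subseteq> L + L'"
  using set_plus_intro[of _ L 0 L'] set_plus_intro[of 0 L _ L']
    superlattice_zero[OF assms(1)] superlattice_zero[OF assms(2)]
  by (metis add_0_right subsetI, metis add_0_left subsetI)

lemma plus_in_superlattices:
  assumes "L \<in> superlattices" "L' \<in> superlattices"
  shows "L + L' \<in> superlattices"
proof -
  obtain N where N: "N > 0" "\<And>x. x \<in> L \<Longrightarrow> real N *\<^sub>R x \<in> std_lattice"
    using assms(1) unfolding superlattices_iff by blast
  obtain N' where N': "N' > 0" "\<And>x. x \<in> L' \<Longrightarrow> real N' *\<^sub>R x \<in> std_lattice"
    using assms(2) unfolding superlattices_iff by blast
  have "real (N * N') *\<^sub>R x \<in> std_lattice" if "x \<in> L" for x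
    using std_lattice_scaleR[OF N(2)[OF that], of "real N'"] by (simp add: mult.commute)
  moreover have "real (N * N') *\<^sub>R x \<in> std_lattice" if "x \<in> L'" for x
    using std_lattice_scaleR[OF N'(2)[OF that], of "real N"] by simp
  ultimately have "real (N * N') *\<^sub>R x \<in> std_lattice" if "x \<in> L + L'" for x
    using scaleR_plus_in_std_lattice[of L "N * N'" L'] that by blast
  moreover have "N * N' > 0" using N N' by simp
  moreover have "x - y \<in> L + L'" if xy: "x \<in> L + L'" "y \<in> L + L'" for x y
  proof -
    obtain a b c d where "a \<in> L" "b \<in> L'" "c \<in> L" "d \<in> L'" "x = a + b" "y = c + d"
      using xy by (auto simp: set_plus_def)
    then have "x - y = (a - c) + (b - d)" "a - c \<in> L" "b - d \<in> L'"
      using assms superlattice_diff by simp_all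
    then show ?thesis using set_plus_intro by metis
  qed
  moreover have "std_lattice \<subseteq> L + L'"
    using subset_plus[OF assms] std_lattice_subset[OF assms(1)] by blast
  ultimately show ?thesis unfolding superlattices_iff by blast
qed

lemma plus_subset_superlattice:
  assumes "M \<in> superlattices" "L \<subseteq> M" "L' \<subseteq> M"
  shows "L + L' \<subseteq> M"
proof
  fix z assume "z \<in> L + L'"
  then obtain x y where xy: "x \<in> M" "y \<in> M" "z = x + y" using assms(2,3) by (auto simp: set_plus_def)
  have "x - (0 - y) \<in> M" using xy superlattice_diff superlattice_zero assms(1) by blast
  then show "z \<in> M" using xy by simp
qed

text \<open>Over a common denominator this is additivity of \<open>A\<close>; the denominators are cleared by cancelling
integers in the profinite integers, which have no \<open>\<int>\<close>-torsion.\<close>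

lemma integral_on_plus:
  assumes L: "L \<in> superlattices" and L': "L' \<in> superlattices"
  shows "integral_on A (L + L') \<longleftrightarrow> integral_on A L \<and> integral_on A L'"
proof
  assume "integral_on A (L + L')"
  then show "integral_on A L \<and> integral_on A L'"
    using integral_on_mono subset_plus[OF assms] by blast
next
  assume int: "integral_on A L \<and> integral_on A L'"
  show "integral_on A (L + L')"
    unfolding integral_on_def
  proof (intro allI impI)
    fix N w i assume N: "0 < N" and "(1 / real N) *\<^sub>R int_vec w \<in> L + L'"
    then obtain x x' where x: "x \<in> L" "x' \<in> L'" "(1 / real N) *\<^sub>R int_vec w = x + x'"
      by (auto simp: set_plus_def)
    obtain D u where u: "D > 0" "x = (1 / real D) *\<^sub>R int_vec u"
      using superlattice_rational[OF L x(1)] by blast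
    obtain D' u' where u': "D' > 0" "x' = (1 / real D') *\<^sub>R int_vec u'"
      using superlattice_rational[OF L' x(2)] by blast
    have "real_of_int (int (D * D') * w $ j) = real_of_int (int (N * D') * u $ j + int (N * D) * u' $ j)" for j
    proof -
      have "(1 / real N) * real_of_int (w $ j) = (1 / real D) * real_of_int (u $ j) + (1 / real D') * real_of_int (u' $ j)"
        using arg_cong[OF x(3), of "\<lambda>v. v $ j"] unfolding u(2) u'(2) by simp
      then show ?thesis using N u(1) u'(1) by (simp add: field_simps)
    qed
    then have "int (D * D') * w $ j = int (N * D') * u $ j + int (N * D) * u' $ j" for j
      using of_int_eq_iff by blast
    then have "of_int (int (D * D') * w $ j) = (of_int (int (N * D') * u $ j + int (N * D) * u' $ j) :: zhat)" for j
      by (rule arg_cong)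
    then have w: "of_nat (D * D') *s (int_vec w :: zhat^2) =
        of_nat (N * D') *s int_vec u + of_nat (N * D) *s int_vec u'"
      by (simp add: vec_eq_iff)
    have "of_nat D dvd (A *v int_vec u) $ i" "of_nat D' dvd (A *v int_vec u') $ i"
      using int x(1,2) u u' unfolding integral_on_def by blast+
    then obtain k k' where k: "(A *v int_vec u) $ i = of_nat D * k" "(A *v int_vec u') $ i = of_nat D' * k'"
      by (auto elim!: dvdE)
    have "of_nat (D * D') * (A *v int_vec w) $ i = (A *v (of_nat (D * D') *s int_vec w)) $ i"
      by (simp add: mat_vec_scale)
    also have "\<dots> = of_nat (N * D') * (of_nat D * k) + of_nat (N * D) * (of_nat D' * k')"
      unfolding w by (simp add: mat_vec_scale matrix_vector_right_distrib k)
    also have "\<dots> = of_nat (D * D' * N) * (k + k')" by (simp add: algebra_simps)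
    finally have "of_nat (D * D' * N) dvd of_nat (D * D') * (A *v int_vec w) $ i" by simp
    moreover have "0 < D * D'" using u(1) u'(1) by simp
    ultimately show "of_nat N dvd (A *v int_vec w) $ i"
      by (rule zhat_mult_dvd_cancel[rotated])
  qed
qed

text \<open>An integral matrix is integral on \<open>L\<close> iff it maps \<open>L\<close> into \<open>\<int>\<^sup>2\<close>, since divisibility of integers can
be tested in the profinite integers.\<close>

lemma integral_on_int_mat:
  assumes L: "L \<in> superlattices" and s: "det s > 0"
  shows "integral_on (int_mat s) L \<longleftrightarrow> L \<subseteq> lattice_of s"
proof
  assume int: "integral_on (int_mat s) L"
  show "L \<subseteq> lattice_of s"
  proof
    fix x assume x: "x \<in> L"
    obtain D w where D: "D > 0" "x = (1 / real D) *\<^sub>R int_vec w"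
      using superlattice_rational[OF L x] by blast
    have "of_nat D dvd (of_int ((s *v w) $ i) :: zhat)" for i
      using int x D unfolding integral_on_def zhat_mat_vec_int[symmetric] by blast
    then have "int D dvd (s *v w) $ i" for i using dvd_of_int_zhat D(1) by blast
    then have "real_of_int ((s *v w) $ i) / real D \<in> \<int>" for i
      using D(1) by (metis of_int_divide_in_Ints of_int_of_nat_eq)
    then show "x \<in> lattice_of s"
      unfolding mem_lattice_of[OF s] D(2)
      by (simp add: matrix_vector_mult_scaleR int_mat_vec std_lattice_def)
  qed
next
  assume "L \<subseteq> lattice_of s"
  moreover have "int_mat s \<in> left_ideal s"
    unfolding left_ideal_def by (auto intro!: exI[of _ "mat 1"])
  ultimately show "integral_on (int_mat s) L"
    using left_ideal_iff_integral_on[OF s] integral_on_mono by blast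
qed

lemma lattice_projection_family_lattice_proj: "lattice_projection_family lattice_proj"
  unfolding lattice_projection_family_def projection_def
  by (intro conjI ballI inv_fun_eqI)
    (auto simp: app_lattice_proj_superlattice plus_in_superlattices integral_on_plus)

section \<open>Lattices of bounded denominator\<close>

definition level :: "nat \<Rightarrow> (real^2) set set" where
  "level N = {L\<in>superlattices. \<forall>x\<in>L. real N *\<^sub>R x \<in> std_lattice}"

lemma plus_in_level: "L \<in> level N \<Longrightarrow> L' \<in> level N \<Longrightarrow> L + L' \<in> level N"
  unfolding level_def using plus_in_superlattices scaleR_plus_in_std_lattice by blast

text \<open>A lattice of level \<open>N\<close> is the union of the translates by \<open>\<int>\<^sup>2\<close> of its points \<open>w / N\<close> in the unit
square.\<close>

lemma finite_level:
  assumes "N > 0"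
  shows "finite (level N)"
proof -
  define box where "box = {w :: int^2. \<forall>i. w $ i \<in> {0..<int N}}"
  define R where "R L = {w\<in>box. (1 / real N) *\<^sub>R int_vec w \<in> L}" for L :: "(real^2) set"
  have "finite box"
  proof (rule finite_subset)
    show "box \<subseteq> (\<lambda>(a, b). \<chi> i. if i = 1 then a else b) ` ({0..<int N} \<times> {0..<int N})"
    proof
      fix w assume w: "w \<in> box"
      have "w = (\<lambda>(a, b). \<chi> i. if i = 1 then a else b) (w $ 1, w $ 2)"
        by (simp add: vec_eq_iff forall_2)
      then show "w \<in> (\<lambda>(a, b). \<chi> i. if i = 1 then a else b) ` ({0..<int N} \<times> {0..<int N})"
        using w unfolding box_def by (intro rev_image_eqI[of "(w $ 1, w $ 2)"]) auto
    qed
  qed simp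
  have sub: "L \<subseteq> L'" if L: "L \<in> level N" "L' \<in> level N" "R L = R L'" for L L'
  proof
    fix x assume x: "x \<in> L"
    obtain w where w: "real N *\<^sub>R x = int_vec w"
      using L(1) x unfolding level_def std_lattice_eq by blast
    define r :: "int^2" where "r = (\<chi> i. w $ i mod int N)"
    define z :: "int^2" where "z = (\<chi> i. w $ i div int N)"
    have "real_of_int (w $ i) = real N * real_of_int (z $ i) + real_of_int (r $ i)" for i
      unfolding z_def r_def vec_lambda_beta
      by (metis mult_div_mod_eq of_int_add of_int_mult of_int_of_nat_eq)
    then have "x = int_vec z + (1 / real N) *\<^sub>R int_vec r"
      using w assms by (simp add: vec_eq_iff field_simps)
    then have r: "(1 / real N) *\<^sub>R int_vec r = x - int_vec z" by simp
    have z: "int_vec z \<in> M" if "M \<in> level N" for M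
      using that std_lattice_subset unfolding level_def std_lattice_eq by blast
    have diff: "a - b \<in> M" if "M \<in> level N" "a \<in> M" "b \<in> M" for M a b
      using that superlattice_diff unfolding level_def by blast
    have "r \<in> R L"
    proof -
      have "r \<in> box" using assms by (simp add: box_def r_def)
      then show ?thesis using diff[OF L(1) x z[OF L(1)]] by (simp add: R_def r)
    qed
    then have "r \<in> R L'" using L(3) by simp
    then have "x - int_vec z \<in> L'" by (simp add: R_def r)
    then have "(x - int_vec z) - (0 - int_vec z) \<in> L'"
      using diff[OF L(2)] z[OF L(2)] L(2) superlattice_zero unfolding level_def by blast
    then show "x \<in> L'" by simp
  qed
  then have "inj_on R (level N)" by (intro inj_onI equalityI) simp_all
  moreover have "R ` level N \<subseteq> Pow box" by (auto simp: R_def)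
  ultimately show ?thesis
    using \<open>finite box\<close> by (meson finite_Pow_iff inj_on_finite)
qed

lemma level_mono:
  assumes "N dvd N'"
  shows "level N \<subseteq> level N'"
proof -
  obtain k where k: "N' = N * k" using assms by (rule dvdE)
  have "real N' *\<^sub>R x \<in> std_lattice" if "real N *\<^sub>R x \<in> std_lattice" for x
    using std_lattice_scaleR[OF that, of "real k"] by (simp add: k mult.commute)
  then show ?thesis unfolding level_def by blast
qed

text \<open>Factorials are cofinal for divisibility, so they turn the directed system of levels into a sequence.\<close>

lemma superlattice_eventually_in_level:
  assumes "L \<in> superlattices"
  shows "\<forall>\<^sub>F k in sequentially. L \<in> level (fact k)"
proof -
  obtain N where N: "N > 0" "L \<in> level N"
    using assms unfolding superlattices_iff level_def by blast
  have "L \<in> level (fact k)" if "k \<ge> N" for k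
    using N level_mono[of N "fact k"] dvd_fact[of N k] that by auto
  then show ?thesis by (auto simp: eventually_sequentially)
qed

lemma std_lattice_in_level: "N > 0 \<Longrightarrow> std_lattice \<in> level N"
  unfolding level_def superlattices_iff
  using std_lattice_diff std_lattice_scaleR[of _ "real N"] by (auto intro!: exI[of _ N])

section \<open>Orbits modulo N\<close>

definition cong_mat :: "nat \<Rightarrow> zhat mat2 \<Rightarrow> zhat mat2 \<Rightarrow> bool" where
  "cong_mat N A B \<longleftrightarrow> (\<forall>i j. of_nat N dvd A $ i $ j - B $ i $ j)"

lemma cong_mat_sym: "cong_mat N A B \<Longrightarrow> cong_mat N B A"
  unfolding cong_mat_def using dvd_minus_iff[THEN iffD2] by fastforce

lemma cong_mat_trans [trans]: "cong_mat N A B \<Longrightarrow> cong_mat N B C \<Longrightarrow> cong_mat N A C"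
  unfolding cong_mat_def using dvd_add[of "of_nat N" "A $ i $ j - B $ i $ j" "B $ i $ j - C $ i $ j" for i j] by simp

lemma cong_mat_mult_left: "cong_mat N A B \<Longrightarrow> cong_mat N (C ** A) (C ** B)"
  unfolding cong_mat_def
  by (simp add: matrix_matrix_mult_def sum_subtractf[symmetric] right_diff_distrib[symmetric] dvd_sum)

lemma cong_mat_add: "cong_mat N A B \<Longrightarrow> cong_mat N C D \<Longrightarrow> cong_mat N (A + C) (B + D)"
  unfolding cong_mat_def by (simp add: add_diff_add)

lemma row_mult: "(X ** A) $ i = X $ i v* (A :: int mat2)"
  by (simp add: vec_eq_iff vector_matrix_mult_def matrix_matrix_mult_def mult.commute)

text \<open>The rows of \<open>B\<close> modulo \<open>N\<close>, together with \<open>N \<int>\<^sup>2\<close>, span a sublattice of \<open>\<int>\<^sup>2\<close>. Let \<open>s\<close> be a basis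
of it. Then \<open>B\<close> is a left multiple of \<open>s\<close>, so \<open>A\<close> is one too, while modulo \<open>N\<close> the matrix \<open>s\<close> is
itself a left multiple of \<open>B\<close>. The lattice \<open>s\<^sup>-\<^sup>1 \<int>\<^sup>2\<close> has level \<open>N\<close> because \<open>N\<close> is a left multiple of
\<open>s\<close>.\<close>

lemma cong_left_multiple:
  assumes N: "0 < N"
    and le: "\<And>L. L \<in> level N \<Longrightarrow> integral_on B L \<Longrightarrow> integral_on A L"
  shows "\<exists>X. cong_mat N A (X ** B)"
proof -
  have "\<exists>b c. B $ i $ j = of_int b + of_nat N * c" for i j
  proof -
    obtain b where "of_nat N dvd B $ i $ j - of_int b" using ex_int_cong_zhat[OF N] by blast
    then obtain c where "B $ i $ j - of_int b = of_nat N * c" by (rule dvdE)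
    then have "B $ i $ j = of_int b + of_nat N * c" by (simp add: algebra_simps)
    then show ?thesis by blast
  qed
  then obtain b' c' where bc: "\<And>i j. B $ i $ j = of_int (b' i j) + of_nat N * c' i j" by metis
  define b :: "int mat2" where "b = (\<chi> i j. b' i j)"
  define C where "C = (\<chi> i j. c' i j)"
  have BC: "B $ i $ j = of_int (b $ i $ j) + of_nat N * C $ i $ j" for i j
    using bc by (simp add: b_def C_def)
  \<comment> \<open>preimage in \<open>\<int>\<^sup>2\<close> of the row space of \<open>b\<close> modulo \<open>N\<close>\<close>
  define H where "H = range (\<lambda>(z, y). z v* b + int N *s y)"
  have H: "z v* b + int N *s y \<in> H" for z y by (auto simp: H_def)
  obtain s :: "int mat2" where s: "s $ 2 $ 1 = 0" "s $ 1 $ 1 > 0" "s $ 2 $ 2 > 0"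
    and Hs: "H = range (\<lambda>z. z v* s)"
  proof (rule hermite_basis[of "int N" H])
    show "int N *s w \<in> H" for w using H[of 0 w] by simp
    show "x - y \<in> H" if "x \<in> H" "y \<in> H" for x y
    proof -
      obtain z u z' u' where "x = z v* b + int N *s u" "y = z' v* b + int N *s u'"
        using \<open>x \<in> H\<close> \<open>y \<in> H\<close> by (auto simp: H_def)
      then have "x - y = (z - z') v* b + int N *s (u - u')"
        by (simp add: vec_eq_iff vector_matrix_mult_def sum_2 algebra_simps)
      then show ?thesis by (simp only: H)
    qed
  qed (use N in auto)
  have det: "det s > 0" using s by (simp add: det_2)
  have row: "axis i 1 v* M = M $ i" for i and M :: "int mat2"
    using exhaust_2[of i] by (auto simp: vec_eq_iff vector_matrix_mult_def axis_def sum_2)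
  have "\<exists>z y. s $ i = z v* b + int N *s y" for i
  proof -
    have "s $ i \<in> H" unfolding Hs row[symmetric] by blast
    then show ?thesis by (auto simp: H_def)
  qed
  then obtain x y where xy: "\<And>i. s $ i = x i v* b + int N *s y i" by metis
  have "\<exists>z. b $ i = z v* s" for i
    using H[of "axis i 1" 0] unfolding Hs by (auto simp: row)
  then obtain z where z: "\<And>i. b $ i = z i v* s" by metis
  have "\<exists>z. int N *s axis i 1 = z v* s" for i
    using H[of 0 "axis i 1"] unfolding Hs by auto
  then obtain w where w: "\<And>i. int N *s axis i 1 = w i v* s" by metis
  \<comment> \<open>the coefficients of the relations \<open>s = X0 b + N Y\<close>, \<open>b = Z s\<close> and \<open>N = W s\<close>\<close>
  define X0 Y Z W where "X0 = (\<chi> i. x i)" and "Y = (\<chi> i. y i)" and "Z = (\<chi> i. z i)" and "W = (\<chi> i. w i)"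
  have Zs: "Z ** s = b" unfolding vec_eq_iff[of "Z ** s"] row_mult by (simp add: Z_def z)
  have Ws: "W ** s = mat (int N)"
    unfolding vec_eq_iff[of "W ** s"] row_mult
    by (simp add: W_def w[symmetric] vec_eq_iff mat_def axis_def)
  have sX: "s $ i $ j = (X0 ** b) $ i $ j + int N * Y $ i $ j" for i j
    unfolding row_mult by (simp add: xy X0_def Y_def)
  have lat: "lattice_of s \<in> level N"
  proof -
    have "std_lattice \<subseteq> lattice_of s"
      using mem_lattice_of[OF det] by (auto simp: std_lattice_eq int_mat_vec)
    moreover have "x - y \<in> lattice_of s" if "x \<in> lattice_of s" "y \<in> lattice_of s" for x y
      using that unfolding mem_lattice_of[OF det]
      by (simp add: matrix_vector_mult_diff_distrib std_lattice_diff)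
    moreover have "real N *\<^sub>R x \<in> std_lattice" if x: "x \<in> lattice_of s" for x
    proof -
      obtain u where u: "int_mat s *v x = (int_vec u :: real^2)"
        using x unfolding mem_lattice_of[OF det] std_lattice_eq by blast
      have "int_mat W *v (int_mat s *v x) = real N *\<^sub>R x"
        unfolding matrix_vector_mul_assoc int_mat_mult[symmetric] Ws
        by (simp add: vec_eq_iff forall_2 matrix_vector_mult_def int_mat_def mat_def sum_2)
      then have "real N *\<^sub>R x = int_vec (W *v u)" unfolding u int_mat_vec by simp
      then show ?thesis unfolding std_lattice_eq by blast
    qed
    ultimately show ?thesis using N unfolding level_def superlattices_iff by blast
  qed
  have "B = (int_mat Z + C ** int_mat W) ** int_mat s"
  proof -
    have "(int_mat Z + C ** int_mat W) ** int_mat s = int_mat b + C ** int_mat (mat (int N))"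
      unfolding matrix_mult_add_left matrix_mul_assoc[symmetric] int_mat_mult[symmetric] Zs Ws ..
    also have "int_mat (mat (int N)) = (mat (of_nat N) :: zhat mat2)"
      by (simp add: vec_eq_iff int_mat_def mat_def)
    also have "int_mat b + C ** mat (of_nat N) = B"
      by (simp add: vec_eq_iff mat_mult_2 BC int_mat_def mult.commute)
    finally show ?thesis by simp
  qed
  then have "B \<in> left_ideal s" unfolding left_ideal_def by blast
  then have "A \<in> left_ideal s"
    using le[OF lat] left_ideal_iff_integral_on[OF det] by blast
  then obtain D where D: "A = D ** int_mat s" unfolding left_ideal_def by blast
  have "cong_mat N (int_mat s) (int_mat X0 ** int_mat b)"
    unfolding cong_mat_def int_mat_mult[symmetric] by (simp add: int_mat_def sX)
  also have "cong_mat N (int_mat X0 ** int_mat b) (int_mat X0 ** B)"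
    by (intro cong_mat_mult_left) (simp add: cong_mat_def BC int_mat_def)
  finally have "cong_mat N A (D ** (int_mat X0 ** B))"
    unfolding D by (rule cong_mat_mult_left)
  then show ?thesis by (metis matrix_mul_assoc)
qed

text \<open>From \<open>A = X B\<close> and \<open>B = Y A\<close> modulo \<open>N\<close> it follows that \<open>1 - X Y\<close> annihilates \<open>A\<close> modulo \<open>N\<close>. So
\<open>Y\<close> may be changed by any multiple of \<open>1 - X Y\<close>, and the stable range condition provides an
invertible matrix of that kind.\<close>

lemma same_orbit_mod_level:
  assumes N: "0 < N" and same: "\<And>L. L \<in> level N \<Longrightarrow> integral_on A L \<longleftrightarrow> integral_on B L"
  shows "\<exists>g. invertible g \<and> cong_mat N (g ** A) B"
proof -
  obtain X where X: "cong_mat N A (X ** B)" using cong_left_multiple[OF N] same by metis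
  obtain Y where Y: "cong_mat N B (Y ** A)" using cong_left_multiple[OF N] same by metis
  define C where "C = mat 1 - X ** Y"
  obtain T where T: "invertible (Y + T ** C)"
    using stable_range[of X Y C] by (auto simp: C_def)
  have "cong_mat N A (X ** (Y ** A))"
    using X cong_mat_mult_left[OF Y] by (rule cong_mat_trans)
  moreover have "C ** A = A - X ** (Y ** A)"
  proof -
    have "C ** A + X ** Y ** A = A"
      by (simp add: C_def flip: matrix_mult_add_left)
    then show ?thesis by (simp add: matrix_mul_assoc algebra_simps)
  qed
  ultimately have "cong_mat N (C ** A) 0" by (simp add: cong_mat_def)
  then have "cong_mat N (T ** (C ** A)) (T ** 0)" by (rule cong_mat_mult_left)
  then have "cong_mat N (Y ** A + T ** (C ** A)) (B + T ** 0)"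
    by (rule cong_mat_add[OF cong_mat_sym[OF Y]])
  then have "cong_mat N ((Y + T ** C) ** A) B"
    by (simp add: matrix_mult_add_left matrix_mul_assoc)
  then show ?thesis using T by blast
qed

text \<open>The pairs at which \<open>f\<close> varies by at least \<open>\<epsilon>\<close> form a compact set, covered by the open sets of pairs
that are incongruent modulo some \<open>n\<close>, since only equal matrices are congruent modulo every \<open>n\<close>. The
product of the moduli in a finite subcover is as required.\<close>

lemma inv_fun_uniformly_continuous:
  assumes "0 < \<epsilon>"
  shows "\<exists>N>0. \<forall>A B. cong_mat N A B \<longrightarrow> cmod (app_inv_fun f A - app_inv_fun f B) < \<epsilon>"
proof -
  define K where "K = {z. \<epsilon> \<le> cmod (app_inv_fun f (fst z) - app_inv_fun f (snd z))}"
  define U where "U n = {z. \<not> cong_mat (Suc n) (fst z) (snd z)}" for n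
  have "compact (UNIV :: (zhat mat2 \<times> zhat mat2) set)"
    using compact_UNIV_mat2 by (simp add: compact_Times flip: UNIV_Times_UNIV)
  moreover have "closed K"
    unfolding K_def
    by (intro closed_Collect_le continuous_intros continuous_on_compose2[OF continuous_on_inv_fun]) auto
  ultimately have "compact K" using compact_Int_closed[of UNIV K] by simp
  moreover have "open (U n)" for n
  proof -
    have cont: "continuous_on UNIV (\<lambda>z :: zhat mat2 \<times> zhat mat2. fst z $ i $ j + (- 1) * snd z $ i $ j)" for i j
      by (intro continuous_intros)
    have "U n = (\<Union>i. \<Union>j. (\<lambda>z. fst z $ i $ j + (- 1) * snd z $ i $ j) -` (- {x. of_nat (Suc n) dvd x}))"
      unfolding U_def cong_mat_def by (auto simp del: of_nat_Suc)
    moreover have "open (- {x::zhat. of_nat (Suc n) dvd x})"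
      using clopen_dvd_zhat[of "Suc n"] by (simp add: open_Compl)
    ultimately show ?thesis using open_vimage[OF _ cont] by (simp add: open_UN)
  qed
  moreover have "K \<subseteq> (\<Union>n. U n)"
  proof
    fix z assume "z \<in> K"
    then have "fst z \<noteq> snd z" using assms by (auto simp: K_def)
    then obtain i j where "fst z $ i $ j \<noteq> snd z $ i $ j" by (auto simp: vec_eq_iff)
    then have "fst z $ i $ j - snd z $ i $ j \<noteq> 0" by simp
    then obtain p n where p: "prime p" "zhat_residue (fst z $ i $ j - snd z $ i $ j) p n \<noteq> 0"
      using zhat_eqI[of _ 0] by (metis zhat_residue_ring_ops(1))
    \<comment> \<open>\<open>p ^ n\<close> separates the two entries; \<open>U\<close> is indexed by the predecessor of the modulus\<close>
    have "\<not> of_nat (p ^ n) dvd fst z $ i $ j - snd z $ i $ j"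
    proof
      assume "of_nat (p ^ n) dvd fst z $ i $ j - snd z $ i $ j"
      then obtain k where k: "fst z $ i $ j - snd z $ i $ j = of_nat (p ^ n) * k" by (rule dvdE)
      show False using p(2) unfolding k using p(1) by (simp del: of_nat_power) (simp add: mod_simps)
    qed
    then have "\<not> cong_mat (Suc (p ^ n - 1)) (fst z) (snd z)"
      using p(1) prime_gt_0_nat[of p] unfolding cong_mat_def by (auto simp del: of_nat_power of_nat_Suc)
    then show "z \<in> (\<Union>n. U n)" unfolding U_def by blast
  qed
  ultimately obtain F where F: "finite F" "K \<subseteq> (\<Union>n\<in>F. U n)"
    using compactE_image[of K UNIV U] by metis
  define N where "N = (\<Prod>n\<in>F. Suc n)"
  have "cmod (app_inv_fun f A - app_inv_fun f B) < \<epsilon>" if "cong_mat N A B" for A B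
  proof (rule ccontr)
    assume "\<not> ?thesis"
    then have "(A, B) \<in> K" by (simp add: K_def)
    then obtain n where n: "n \<in> F" "\<not> cong_mat (Suc n) A B" using F(2) by (auto simp: U_def)
    have "Suc n dvd N" unfolding N_def using F(1) n(1) by (rule dvd_prodI)
    then have "(of_nat (Suc n) :: zhat) dvd of_nat N" by (metis dvdE dvd_triv_left of_nat_mult)
    then show False using n(2) that unfolding cong_mat_def by (meson dvd_trans)
  qed
  moreover have "N > 0" by (simp add: N_def prod_pos)
  ultimately show ?thesis by blast
qed

lemma inv_fun_close_of_same_level:
  assumes "0 < \<epsilon>"
  shows "\<exists>N>0. \<forall>A B. (\<forall>L\<in>level N. integral_on A L \<longleftrightarrow> integral_on B L) \<longrightarrow>
    cmod (app_inv_fun f A - app_inv_fun f B) < \<epsilon>"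
proof -
  obtain N where N: "N > 0"
    and close: "\<And>A B. cong_mat N A B \<Longrightarrow> cmod (app_inv_fun f A - app_inv_fun f B) < \<epsilon>"
    using inv_fun_uniformly_continuous[OF assms] by blast
  have "cmod (app_inv_fun f A - app_inv_fun f B) < \<epsilon>"
    if same: "\<forall>L\<in>level N. integral_on A L \<longleftrightarrow> integral_on B L" for A B
  proof -
    obtain g where "invertible g" "cong_mat N (g ** A) B"
      using same_orbit_mod_level[OF N, of A B] same by blast
    moreover from this have "app_inv_fun f (g ** A) = app_inv_fun f A"
      using app_inv_fun[of f] by blast
    ultimately show ?thesis using close[of "g ** A" B] by simp
  qed
  then show ?thesis using N by blast
qed

section \<open>Approximation by finitely many lattice projections\<close>

lemma projection_semilattice_level:
  assumes \<rho>: "lattice_projection_family \<rho>" and N: "0 < N"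
  shows "projection_semilattice (level N) (+) \<rho>"
proof
  show "finite (level N)" using N by (rule finite_level)
  fix L M assume LM: "L \<in> level N" "M \<in> level N"
  then have sup: "L \<in> superlattices" "M \<in> superlattices" by (simp_all add: level_def)
  show "L + M \<in> level N" using LM by (rule plus_in_level)
  show "\<rho> L * \<rho> M = \<rho> (L + M)" "star (\<rho> L) = \<rho> L"
    using \<rho> sup unfolding lattice_projection_family_def projection_def by blast+
  show "L + M \<le> K \<longleftrightarrow> L \<le> K \<and> M \<le> K" if "K \<in> level N" for K
    using that subset_plus[OF sup] plus_subset_superlattice[of K L M] unfolding level_def by blast
qed

text \<open>A sample point for the lattice \<open>L\<close>: a matrix that, by \<open>integral_on_lattice_mat\<close>, is integral on exactly
the sublattices of \<open>L\<close>.\<close>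

definition lattice_mat :: "(real^2) set \<Rightarrow> int mat2" where
  "lattice_mat L = (SOME s. det s > 0 \<and> L = lattice_of s)"

lemma lattice_mat:
  assumes "L \<in> superlattices"
  shows "det (lattice_mat L) > 0" "lattice_of (lattice_mat L) = L"
proof -
  have "\<exists>s. det s > 0 \<and> L = lattice_of s" using superlattice_obtains[OF assms] by blast
  from someI_ex[OF this] show "det (lattice_mat L) > 0" "lattice_of (lattice_mat L) = L"
    unfolding lattice_mat_def by simp_all
qed

lemma integral_on_lattice_mat:
  assumes "L \<in> superlattices" "M \<in> superlattices"
  shows "integral_on (int_mat (lattice_mat M)) L \<longleftrightarrow> L \<subseteq> M"
  using integral_on_int_mat[OF assms(1) lattice_mat(1)[OF assms(2)]] lattice_mat(2)[OF assms(2)] by simp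

definition level_hom :: "nat \<Rightarrow> ((real^2) set \<Rightarrow> 'b::cstar_algebra) \<Rightarrow> inv_fun \<Rightarrow> 'b" where
  "level_hom N \<rho> f =
     (\<Sum>M\<in>level N. app_inv_fun f (int_mat (lattice_mat M)) *\<^sub>C atom (level N) \<rho> M)"

lemma star_hom_level_hom:
  assumes "lattice_projection_family \<rho>" "0 < N"
  shows "star_hom (level_hom N \<rho>)"
  unfolding level_hom_def
  by (rule projection_semilattice.star_hom_atom_sum[OF projection_semilattice_level[OF assms]])

text \<open>The samples of \<open>\<pi>\<^sub>L\<close> select the atoms above \<open>L\<close>, and these add up to \<open>\<rho> L\<close>.\<close>

lemma level_hom_lattice_proj:
  assumes \<rho>: "lattice_projection_family \<rho>" and N: "0 < N" and L: "L \<in> level N"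
  shows "level_hom N \<rho> (lattice_proj L) = \<rho> L"
proof -
  interpret projection_semilattice "level N" "(+)" \<rho>
    by (rule projection_semilattice_level[OF \<rho> N])
  have "level_hom N \<rho> (lattice_proj L) = (\<Sum>M\<in>level N. if L \<le> M then e M else 0)"
    unfolding level_hom_def
  proof (intro sum.cong refl)
    fix M assume "M \<in> level N"
    then have "L \<in> superlattices" "M \<in> superlattices" using L by (simp_all add: level_def)
    then show "app_inv_fun (lattice_proj L) (int_mat (lattice_mat M)) *\<^sub>C e M = (if L \<le> M then e M else 0)"
      by (simp add: app_lattice_proj_superlattice integral_on_lattice_mat)
  qed
  also have "\<dots> = (\<Sum>M\<in>{M\<in>level N. L \<le> M}. e M)"
    using finite_P by (rule sum.inter_filter[symmetric])
  also have "\<dots> = \<rho> L" using L by (rule sum_atoms_above)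
  finally show ?thesis .
qed

lemma integral_on_std_lattice: "integral_on A std_lattice"
proof -
  have eq: "lattice_of (mat 1) = std_lattice"
  proof -
    have "int_mat (mat 1) = (mat 1 :: real mat2)" by (simp add: vec_eq_iff int_mat_def mat_def)
    then show ?thesis using mem_lattice_of[of "mat 1"] by auto
  qed
  have "int_mat (mat 1) = (mat 1 :: zhat mat2)" by (simp add: vec_eq_iff int_mat_def mat_def)
  then have "A \<in> left_ideal (mat 1)" unfolding left_ideal_def by simp
  then show ?thesis using left_ideal_iff_integral_on[of "mat 1" A] by (simp add: eq)
qed

lemma app_sum_scaleC:
  "app_inv_fun (\<Sum>M\<in>P. c M *\<^sub>C g M) A = (\<Sum>M\<in>P. c M * app_inv_fun (g M) A)"
  by (induction P rule: infinite_finite_induct) simp_all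

text \<open>At a fixed matrix \<open>A\<close> the atoms are weights \<open>0\<close> or \<open>1\<close> with sum \<open>1\<close>, and an atom \<open>e M\<close> with weight \<open>1\<close>
forces \<open>A\<close> to be integral on the same lattices of level \<open>N\<close> as the sample point of \<open>M\<close>. So the value
of \<open>f\<close> there is close to \<open>f A\<close>.\<close>

lemma level_hom_approximates:
  assumes "0 < \<epsilon>"
  shows "\<exists>N>0. norm (f - level_hom N lattice_proj f) \<le> \<epsilon>"
proof -
  obtain N where N: "N > 0"
    and close: "\<And>A B. (\<And>L. L \<in> level N \<Longrightarrow> integral_on A L \<longleftrightarrow> integral_on B L) \<Longrightarrow>
      cmod (app_inv_fun f A - app_inv_fun f B) < \<epsilon>"
    using inv_fun_close_of_same_level[OF assms, of f] by metis
  interpret projection_semilattice "level N" "(+)" lattice_proj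
    by (rule projection_semilattice_level[OF lattice_projection_family_lattice_proj N])
  have "cmod (app_inv_fun (f - level_hom N lattice_proj f) A) \<le> \<epsilon>" for A
  proof -
    define w where "w M = app_inv_fun (e M) A" for M
    have w01: "w M = 0 \<or> w M = 1" if "M \<in> level N" for M
      using arg_cong[OF atom_mult_atom[OF that that], of "\<lambda>g. app_inv_fun g A"] by (simp add: w_def)
    have "(\<Sum>M\<in>level N. e M) = (\<Sum>M\<in>{M\<in>level N. std_lattice \<le> M}. e M)"
      using std_lattice_subset by (intro sum.cong) (auto simp: level_def)
    also have "\<dots> = lattice_proj std_lattice"
      using std_lattice_in_level[OF N] by (rule sum_atoms_above)
    finally have "app_inv_fun (\<Sum>M\<in>level N. 1 *\<^sub>C e M) A = app_inv_fun (lattice_proj std_lattice) A" by simp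
    then have w1: "(\<Sum>M\<in>level N. w M) = 1"
      using std_lattice_in_level[OF N] unfolding app_sum_scaleC
      by (simp add: w_def level_def app_lattice_proj_superlattice integral_on_std_lattice)
    have le: "cmod ((app_inv_fun f A - app_inv_fun f (int_mat (lattice_mat M))) * w M) \<le> \<epsilon> * Re (w M)"
      if M: "M \<in> level N" for M
    proof (cases "w M = 0")
      case False
      then have "w M = 1" using w01[OF M] by simp
      have "integral_on A L \<longleftrightarrow> integral_on (int_mat (lattice_mat M)) L" if L: "L \<in> level N" for L
      proof -
        have sup: "L \<in> superlattices" "M \<in> superlattices" using L M by (simp_all add: level_def)
        have "app_inv_fun (lattice_proj L) A * w M = (if L \<le> M then w M else 0)"
          using arg_cong[OF rho_mult_atom[OF M L], of "\<lambda>g. app_inv_fun g A"]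
          by (simp add: w_def split: if_splits)
        then show ?thesis
          using \<open>w M = 1\<close> sup
          by (simp add: app_lattice_proj_superlattice integral_on_lattice_mat split: if_splits)
      qed
      then show ?thesis using close[of A] \<open>w M = 1\<close> by (simp add: less_imp_le)
    qed simp
    have "app_inv_fun (f - level_hom N lattice_proj f) A =
        app_inv_fun f A * (\<Sum>M\<in>level N. w M) - (\<Sum>M\<in>level N. app_inv_fun f (int_mat (lattice_mat M)) * w M)"
      unfolding level_hom_def w1 by (simp add: app_sum_scaleC w_def)
    also have "\<dots> = (\<Sum>M\<in>level N. (app_inv_fun f A - app_inv_fun f (int_mat (lattice_mat M))) * w M)"
      by (simp add: sum_distrib_left sum_subtractf left_diff_distrib)
    also have "cmod \<dots> \<le> (\<Sum>M\<in>level N. \<epsilon> * Re (w M))"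
      by (intro sum_norm_le le)
    also have "\<dots> = \<epsilon> * Re (\<Sum>M\<in>level N. w M)" by (simp add: sum_distrib_left)
    finally show ?thesis by (simp add: w1)
  qed
  then show ?thesis using N norm_inv_fun_le by blast
qed

lemma cstar_subalgebra_sum:
  assumes "cstar_subalgebra S" "\<And>i. i \<in> I \<Longrightarrow> g i \<in> S"
  shows "(\<Sum>i\<in>I. g i) \<in> S"
  using assms(2) by (induction I rule: infinite_finite_induct) (use assms(1) in \<open>auto simp: cstar_subalgebra_def\<close>)

lemma atom_in_cstar_subalgebra:
  assumes S: "cstar_subalgebra S" and \<rho>: "lattice_projection_family \<rho>" "0 < N"
    and sub: "\<rho> ` superlattices \<subseteq> S" and M: "M \<in> level N"
  shows "atom (level N) \<rho> M \<in> S"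
proof -
  interpret projection_semilattice "level N" "(+)" \<rho>
    by (rule projection_semilattice_level[OF \<rho>])
  show ?thesis
    using M
  proof (induction M rule: descend_induct)
    case (step M)
    have "(\<Sum>K\<in>{K\<in>level N. M < K}. e K) \<in> S"
      using step by (intro cstar_subalgebra_sum[OF S]) auto
    then have "(-1) *\<^sub>C (\<Sum>K\<in>{K\<in>level N. M < K}. e K) \<in> S" using S by (simp add: cstar_subalgebra_def)
    moreover have "\<rho> M \<in> S" using sub step.hyps by (auto simp: level_def)
    ultimately have "\<rho> M + (-1) *\<^sub>C (\<Sum>K\<in>{K\<in>level N. M < K}. e K) \<in> S"
      using S unfolding cstar_subalgebra_def by blast
    then show ?case by (simp add: atom_eq[of M] scaleC_minus_one)
  qed
qed

lemma cstar_generated_lattice_proj: "cstar_generated (lattice_proj ` superlattices) = UNIV"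
proof -
  have "f \<in> S" if S: "cstar_subalgebra S" and sub: "lattice_proj ` superlattices \<subseteq> S" for S f
  proof -
    have "level_hom N lattice_proj f \<in> S" if "0 < N" for N
      unfolding level_hom_def
    proof (rule cstar_subalgebra_sum[OF S])
      fix M assume "M \<in> level N"
      then have "atom (level N) lattice_proj M \<in> S"
        using atom_in_cstar_subalgebra[OF S lattice_projection_family_lattice_proj that sub] by blast
      then show "app_inv_fun f (int_mat (lattice_mat M)) *\<^sub>C atom (level N) lattice_proj M \<in> S"
        using S by (simp add: cstar_subalgebra_def)
    qed
    then have "\<exists>g\<in>S. dist g f < \<epsilon>" if "0 < \<epsilon>" for \<epsilon>
      using level_hom_approximates[of "\<epsilon> / 2" f] that
      by (metis dist_commute dist_norm field_sum_of_halves half_gt_zero less_add_same_cancel1 order_le_less_trans)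
    then have "f \<in> closure S" by (simp add: closure_approachable)
    then show "f \<in> S" using S by (simp add: cstar_subalgebra_def)
  qed
  then show ?thesis unfolding cstar_generated_def by blast
qed

lemma subalgebra_eq_UNIV:
  assumes "cstar_subalgebra S" "\<And>L. L \<in> superlattices \<Longrightarrow> lattice_proj L \<in> S"
  shows "f \<in> S"
  using assms cstar_generated_lattice_proj unfolding cstar_generated_def by blast

lemma continuous_star_hom:
  fixes \<psi> :: "inv_fun \<Rightarrow> 'b::cstar_algebra"
  assumes "star_hom \<psi>"
  shows "continuous_on UNIV \<psi>"
proof -
  have "dist (\<psi> f) (\<psi> g) \<le> 1 * dist f g" for f g
    using star_hom_norm_le[OF assms, of "f - g"] by (simp add: dist_norm star_hom_diff[OF assms])
  then have "1-lipschitz_on UNIV \<psi>" by (intro lipschitz_onI) simp_all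
  then show ?thesis by (rule lipschitz_on_continuous_on)
qed

lemma star_hom_eqI:
  fixes \<phi> \<psi> :: "inv_fun \<Rightarrow> 'b::cstar_algebra"
  assumes \<phi>: "star_hom \<phi>" and \<psi>: "star_hom \<psi>"
    and eq: "\<And>L. L \<in> superlattices \<Longrightarrow> \<phi> (lattice_proj L) = \<psi> (lattice_proj L)"
  shows "\<phi> = \<psi>"
proof
  fix f
  have "closed {f. \<phi> f = \<psi> f}"
    using continuous_star_hom[OF \<phi>] continuous_star_hom[OF \<psi>] by (rule closed_Collect_eq)
  moreover have "\<phi> 0 = \<psi> 0" using star_hom_diff[OF \<phi>, of 0 0] star_hom_diff[OF \<psi>, of 0 0] by simp
  ultimately have "cstar_subalgebra {f. \<phi> f = \<psi> f}"
    using \<phi> \<psi> by (simp add: cstar_subalgebra_def star_hom_def)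
  from subalgebra_eq_UNIV[OF this, of f] show "\<phi> f = \<psi> f" using eq by simp
qed

section \<open>The universal homomorphism\<close>

lemma tendsto_star:
  fixes X :: "nat \<Rightarrow> 'a::cstar_algebra"
  assumes "X \<longlonglongrightarrow> l"
  shows "(\<lambda>k. star (X k)) \<longlonglongrightarrow> star l"
proof -
  have "(\<lambda>k. norm (X k - l)) \<longlonglongrightarrow> 0" using assms by (simp add: LIM_zero_iff tendsto_norm_zero_iff)
  then have "(\<lambda>k. norm (star (X k) - star l)) \<longlonglongrightarrow> 0" by (simp add: norm_star flip: star_diff)
  then show ?thesis by (simp add: LIM_zero_iff tendsto_norm_zero_iff)
qed

lemma tendsto_scaleC:
  fixes X :: "nat \<Rightarrow> 'a::cstar_algebra"
  assumes "X \<longlonglongrightarrow> l"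
  shows "(\<lambda>k. c *\<^sub>C X k) \<longlonglongrightarrow> c *\<^sub>C l"
proof -
  have eq: "c *\<^sub>C X k - c *\<^sub>C l = c *\<^sub>C (X k - l)" for k
    using scaleC_add_right[of c "X k - l" l] by simp
  have "(\<lambda>k. norm (X k - l)) \<longlonglongrightarrow> 0" using assms by (simp add: LIM_zero_iff tendsto_norm_zero_iff)
  then have "(\<lambda>k. cmod c * norm (X k - l)) \<longlonglongrightarrow> 0" by (rule tendsto_mult_right_zero)
  then have "(\<lambda>k. norm (c *\<^sub>C X k - c *\<^sub>C l)) \<longlonglongrightarrow> 0" by (simp add: eq norm_scaleC)
  then show ?thesis by (simp add: LIM_zero_iff tendsto_norm_zero_iff)
qed

lemma level_hom_tendsto:
  assumes \<rho>: "lattice_projection_family \<rho>" and L: "L \<in> superlattices"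
  shows "(\<lambda>k. level_hom (fact k) \<rho> (lattice_proj L)) \<longlonglongrightarrow> \<rho> L"
proof (rule tendsto_eventually)
  show "\<forall>\<^sub>F k in sequentially. level_hom (fact k) \<rho> (lattice_proj L) = \<rho> L"
    using superlattice_eventually_in_level[OF L]
    by eventually_elim (simp add: level_hom_lattice_proj[OF \<rho>])
qed

text \<open>Since the homomorphisms of all levels are contractive, the set of \<open>f\<close> with convergent images is closed.
It is a star subalgebra, and the sequences of the generators are eventually constant.\<close>

lemma convergent_level_hom:
  fixes \<rho> :: "(real^2) set \<Rightarrow> 'b::cstar_algebra"
  assumes \<rho>: "lattice_projection_family \<rho>"
  shows "convergent (\<lambda>k. level_hom (fact k) \<rho> f)"
proof -
  define h where "h k = level_hom (fact k) \<rho>" for k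
  have h: "star_hom (h k)" for k
    unfolding h_def using \<rho> by (intro star_hom_level_hom) simp_all
  define S where "S = {f. convergent (\<lambda>k. h k f)}"
  have "closed S"
    unfolding closure_subset_eq[symmetric]
  proof
    fix f assume f: "f \<in> closure S"
    have "Cauchy (\<lambda>k. h k f)"
    proof (rule metric_CauchyI)
      fix \<epsilon> :: real assume "0 < \<epsilon>"
      then obtain g where g: "g \<in> S" "dist g f < \<epsilon> / 3"
        using f unfolding closure_approachable by (metis zero_less_divide_iff zero_less_numeral)
      have near: "dist (h k f) (h k g) < \<epsilon> / 3" for k
        using star_hom_norm_le[OF h, of k "f - g"] g(2)
        by (simp add: dist_norm star_hom_diff[OF h] norm_minus_commute)
      have "Cauchy (\<lambda>k. h k g)" using g(1) by (simp add: S_def Cauchy_convergent_iff)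
      then obtain M where M: "\<And>m n. m \<ge> M \<Longrightarrow> n \<ge> M \<Longrightarrow> dist (h m g) (h n g) < \<epsilon> / 3"
        using metric_CauchyD[of "\<lambda>k. h k g" "\<epsilon> / 3"] \<open>0 < \<epsilon>\<close> by auto
      have "dist (h m f) (h n f) < \<epsilon>" if "m \<ge> M" "n \<ge> M" for m n
        using near[of m] near[of n] M[OF that]
          dist_triangle[of "h m f" "h n f" "h m g"] dist_triangle[of "h m g" "h n f" "h n g"]
        by (simp add: dist_commute)
      then show "\<exists>M. \<forall>m\<ge>M. \<forall>n\<ge>M. dist (h m f) (h n f) < \<epsilon>" by blast
    qed
    then show "f \<in> S" by (simp add: S_def Cauchy_convergent_iff)
  qed
  moreover have "0 \<in> S"
    using star_hom_diff[OF h, of _ 0 0] by (simp add: S_def convergent_const)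
  moreover have "f + g \<in> S" "f * g \<in> S" if "f \<in> S" "g \<in> S" for f g
    using that convergent_add[of "\<lambda>k. h k f" "\<lambda>k. h k g"] convergent_mult[of "\<lambda>k. h k f" "\<lambda>k. h k g"] h
    by (simp_all add: S_def star_hom_def)
  moreover have "c *\<^sub>C f \<in> S" "star f \<in> S" if f: "f \<in> S" for c f
  proof -
    obtain l where l: "(\<lambda>k. h k f) \<longlonglongrightarrow> l" using f by (auto simp: S_def convergent_def)
    have "h k (c *\<^sub>C f) = c *\<^sub>C h k f" "h k (star f) = star (h k f)" for k
      using h[of k] by (simp_all add: star_hom_def)
    then show "c *\<^sub>C f \<in> S" "star f \<in> S"
      using convergentI[OF tendsto_scaleC[OF l]] convergentI[OF tendsto_star[OF l]]
      by (simp_all add: S_def)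
  qed
  ultimately have "cstar_subalgebra S" by (simp add: cstar_subalgebra_def)
  moreover have "lattice_proj L \<in> S" if "L \<in> superlattices" for L
    using level_hom_tendsto[OF \<rho> that] by (auto simp: S_def h_def convergent_def)
  ultimately have "f \<in> S" by (rule subalgebra_eq_UNIV)
  then show ?thesis by (simp add: S_def h_def)
qed

lemma ex_star_hom_extending:
  fixes \<rho> :: "(real^2) set \<Rightarrow> 'b::cstar_algebra"
  assumes \<rho>: "lattice_projection_family \<rho>"
  shows "\<exists>\<phi>. star_hom \<phi> \<and> (\<forall>L\<in>superlattices. \<phi> (lattice_proj L) = \<rho> L)"
proof -
  define h where "h k = level_hom (fact k) \<rho>" for k
  have h: "star_hom (h k)" for k
    unfolding h_def using \<rho> by (intro star_hom_level_hom) simp_all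
  define \<phi> where "\<phi> f = lim (\<lambda>k. h k f)" for f
  have lim: "(\<lambda>k. h k f) \<longlonglongrightarrow> \<phi> f" for f
    using convergent_level_hom[OF \<rho>, of f] by (simp add: \<phi>_def h_def convergent_LIMSEQ_iff)
  have limI: "\<phi> f = l" if "(\<lambda>k. h k f) \<longlonglongrightarrow> l" for f l
    using LIMSEQ_unique[OF lim that] .
  have "\<phi> (f + g) = \<phi> f + \<phi> g" "\<phi> (f * g) = \<phi> f * \<phi> g" for f g
    using tendsto_add[OF lim[of f] lim[of g]] tendsto_mult[OF lim[of f] lim[of g]] h
    by (auto intro!: limI simp: star_hom_def)
  moreover have "\<phi> (c *\<^sub>C f) = c *\<^sub>C \<phi> f" "\<phi> (star f) = star (\<phi> f)" for c f
    using tendsto_scaleC[OF lim[of f]] tendsto_star[OF lim[of f]] h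
    by (auto intro!: limI simp: star_hom_def)
  ultimately have "star_hom \<phi>" by (simp add: star_hom_def)
  moreover have "\<phi> (lattice_proj L) = \<rho> L" if "L \<in> superlattices" for L
    using level_hom_tendsto[OF \<rho> that] by (intro limI) (simp add: h_def)
  ultimately show ?thesis by blast
qed

theorem proposition3p5:
  shows "lattice_projection_family lattice_proj \<and>
    cstar_generated (lattice_proj ` superlattices) = UNIV \<and>
    (\<forall>\<rho> :: (real^2) set \<Rightarrow> 'b::cstar_algebra. lattice_projection_family \<rho> \<longrightarrow>
      (\<exists>!\<phi> :: inv_fun \<Rightarrow> 'b. star_hom \<phi> \<and>
        (\<forall>L\<in>superlattices. \<phi> (lattice_proj L) = \<rho> L)))"
proof (intro conjI allI impI)
  show "lattice_projection_family lattice_proj" by (rule lattice_projection_family_lattice_proj)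
  show "cstar_generated (lattice_proj ` superlattices) = UNIV" by (rule cstar_generated_lattice_proj)
  fix \<rho> :: "(real^2) set \<Rightarrow> 'b"
  assume "lattice_projection_family \<rho>"
  then obtain \<phi> where "star_hom \<phi> \<and> (\<forall>L\<in>superlattices. \<phi> (lattice_proj L) = \<rho> L)"
    using ex_star_hom_extending by blast
  then show "\<exists>!\<phi> :: inv_fun \<Rightarrow> 'b. star_hom \<phi> \<and> (\<forall>L\<in>superlattices. \<phi> (lattice_proj L) = \<rho> L)"
    by (intro ex1I[of _ \<phi>]) (auto intro: star_hom_eqI)
qed


end
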